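(* Let $\sigma$ be an order-two $*$-automorphism of a unital C*-algebra $A$. Let $\pi_2$ be an irreducible representation of $A\rtimes_\sigma\mathbb{Z}_2$ on some Hilbert space $\mathcal{H}$, and let $\lambda\in\mathbb{T}$. Denote by $W$ the canonical unitary in $A\rtimes_\sigma\mathbb{Z}_2$ and by $W_{\mathbb{Z}}$ the canonical unitary in $A\rtimes_\sigma\mathbb{Z}$. Set $\pi(a)=\pi_2(a)$ for all $a\in A$ and $\pi(W_{\mathbb{Z}})=\lambda\pi_2(W)$. Then $\pi$ extends uniquely to a representation of $A\rtimes_\sigma\mathbb{Z}$. Moreover, all irreducible representations of $A\rtimes_\sigma\mathbb{Z}$ are obtained this way.
   Context: $\mathbb{T}$ is the unit circle in $\mathbb{C}$. For an order-two $*$-automorphism $\sigma$ of a unital C*-algebra $A$, the crossed-product $A\rtimes_\sigma\mathbb{Z}_2$ is the universal unital C*-algebra generated by $A$ and a unitary $W$ (the canonical unitary) subject to $W^2=1$ and $WaW^*=\sigma(a)$ for all $a\in A$. The crossed-product $A\rtimes_\sigma\mathbb{Z}$ is the universal unital C*-algebra generated by $A$ and a unitary $W_{\mathbb{Z}}$ (the canonical unitary) subject to $W_{\mathbb{Z}}aW_{\mathbb{Z}}^*=\sigma(a)$ for all $a\in A$. Representations are unital $*$-representations on nonzero Hilbert spaces. *)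

theory Defs
  imports "HOL-Algebra.Module" "HOL-Analysis.Inner_Product"
begin

section \<open>Unital C*-algebras\<close>

record 'a cstar_algebra = "(complex, 'a) module" +
  star :: "'a \<Rightarrow> 'a"
  cnorm :: "'a \<Rightarrow> real"

text \<open>
  The zero algebra is not excluded.  Nothing is required of the operations outside the carrier.
\<close>

locale unital_cstar_algebra = ring A for A :: "('a, 'm) cstar_algebra_scheme" (structure) +
  assumes smult_closed: "x \<in> carrier A \<Longrightarrow> c \<odot> x \<in> carrier A"
    and smult_l_distr: "x \<in> carrier A \<Longrightarrow> (c + d) \<odot> x = c \<odot> x \<oplus> d \<odot> x"
    and smult_r_distr: "\<lbrakk>x \<in> carrier A; y \<in> carrier A\<rbrakk> \<Longrightarrow> c \<odot> (x \<oplus> y) = c \<odot> x \<oplus> c \<odot> y"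
    and smult_assoc: "x \<in> carrier A \<Longrightarrow> (c * d) \<odot> x = c \<odot> (d \<odot> x)"
    and smult_one: "x \<in> carrier A \<Longrightarrow> 1 \<odot> x = x"
    and smult_mult_left: "\<lbrakk>x \<in> carrier A; y \<in> carrier A\<rbrakk> \<Longrightarrow> (c \<odot> x) \<otimes> y = c \<odot> (x \<otimes> y)"
    and smult_mult_right: "\<lbrakk>x \<in> carrier A; y \<in> carrier A\<rbrakk> \<Longrightarrow> x \<otimes> (c \<odot> y) = c \<odot> (x \<otimes> y)"
    and star_closed: "x \<in> carrier A \<Longrightarrow> star A x \<in> carrier A"
    and star_star: "x \<in> carrier A \<Longrightarrow> star A (star A x) = x"
    and star_add: "\<lbrakk>x \<in> carrier A; y \<in> carrier A\<rbrakk> \<Longrightarrow> star A (x \<oplus> y) = star A x \<oplus> star A y"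
    and star_smult: "x \<in> carrier A \<Longrightarrow> star A (c \<odot> x) = cnj c \<odot> star A x"
    and star_mult: "\<lbrakk>x \<in> carrier A; y \<in> carrier A\<rbrakk> \<Longrightarrow> star A (x \<otimes> y) = star A y \<otimes> star A x"
    and cnorm_nonneg: "x \<in> carrier A \<Longrightarrow> 0 \<le> cnorm A x"
    and cnorm_eq_zero: "x \<in> carrier A \<Longrightarrow> cnorm A x = 0 \<longleftrightarrow> x = \<zero>"
    and cnorm_triangle: "\<lbrakk>x \<in> carrier A; y \<in> carrier A\<rbrakk> \<Longrightarrow> cnorm A (x \<oplus> y) \<le> cnorm A x + cnorm A y"
    and cnorm_smult: "x \<in> carrier A \<Longrightarrow> cnorm A (c \<odot> x) = cmod c * cnorm A x"
    and cnorm_mult: "\<lbrakk>x \<in> carrier A; y \<in> carrier A\<rbrakk> \<Longrightarrow> cnorm A (x \<otimes> y) \<le> cnorm A x * cnorm A y"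
    and cstar_identity: "x \<in> carrier A \<Longrightarrow> cnorm A (star A x \<otimes> x) = (cnorm A x)\<^sup>2"
    and cnorm_complete:
      "\<lbrakk>\<forall>n::nat. f n \<in> carrier A; \<forall>e>0. \<exists>N. \<forall>m\<ge>N. \<forall>n\<ge>N. cnorm A (f m \<ominus> f n) < e\<rbrakk>
        \<Longrightarrow> \<exists>x\<in>carrier A. (\<lambda>n. cnorm A (f n \<ominus> x)) \<longlonglongrightarrow> 0"

definition unital_star_hom ::
    "('a, 'm) cstar_algebra_scheme \<Rightarrow> ('b, 'n) cstar_algebra_scheme \<Rightarrow> ('a \<Rightarrow> 'b) set" where
  "unital_star_hom A B = {h \<in> ring_hom A B.
     (\<forall>c. \<forall>x\<in>carrier A. h (c \<odot>\<^bsub>A\<^esub> x) = c \<odot>\<^bsub>B\<^esub> h x) \<and>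
     (\<forall>x\<in>carrier A. h (star A x) = star B (h x))}"

definition order_two_automorphism :: "('a, 'm) cstar_algebra_scheme \<Rightarrow> ('a \<Rightarrow> 'a) \<Rightarrow> bool" where
  "order_two_automorphism A \<sigma> \<longleftrightarrow>
     \<sigma> \<in> unital_star_hom A A \<and> bij_betw \<sigma> (carrier A) (carrier A) \<and>
     (\<forall>a\<in>carrier A. \<sigma> (\<sigma> a) = a) \<and> (\<exists>a\<in>carrier A. \<sigma> a \<noteq> a)"

definition unitaries :: "('a, 'm) cstar_algebra_scheme \<Rightarrow> 'a set" where
  "unitaries A = {u \<in> carrier A. star A u \<otimes>\<^bsub>A\<^esub> u = \<one>\<^bsub>A\<^esub> \<and> u \<otimes>\<^bsub>A\<^esub> star A u = \<one>\<^bsub>A\<^esub>}"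

definition unital_cstar_subalgebra :: "('a, 'm) cstar_algebra_scheme \<Rightarrow> 'a set \<Rightarrow> bool" where
  "unital_cstar_subalgebra A S \<longleftrightarrow>
     S \<subseteq> carrier A \<and> \<one>\<^bsub>A\<^esub> \<in> S \<and>
     (\<forall>x\<in>S. \<forall>y\<in>S. x \<oplus>\<^bsub>A\<^esub> y \<in> S \<and> x \<otimes>\<^bsub>A\<^esub> y \<in> S) \<and>
     (\<forall>x\<in>S. star A x \<in> S \<and> (\<forall>c. c \<odot>\<^bsub>A\<^esub> x \<in> S)) \<and>
     (\<forall>x\<in>carrier A. (\<forall>e>0. \<exists>y\<in>S. cnorm A (x \<ominus>\<^bsub>A\<^esub> y) < e) \<longrightarrow> x \<in> S)"

definition cstar_generated_by :: "('a, 'm) cstar_algebra_scheme \<Rightarrow> 'a set \<Rightarrow> bool" where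
  "cstar_generated_by A G \<longleftrightarrow>
     G \<subseteq> carrier A \<and> (\<forall>S. unital_cstar_subalgebra A S \<and> G \<subseteq> S \<longrightarrow> S = carrier A)"


section \<open>Crossed products\<close>

definition covariant_Z ::
    "'a cstar_algebra \<Rightarrow> ('a \<Rightarrow> 'a) \<Rightarrow> 'd cstar_algebra \<Rightarrow> ('a \<Rightarrow> 'd) \<Rightarrow> 'd \<Rightarrow> bool" where
  "covariant_Z A \<sigma> D \<phi> V \<longleftrightarrow>
     \<phi> \<in> unital_star_hom A D \<and> V \<in> unitaries D \<and>
     (\<forall>a\<in>carrier A. V \<otimes>\<^bsub>D\<^esub> \<phi> a \<otimes>\<^bsub>D\<^esub> star D V = \<phi> (\<sigma> a))"

definition covariant_Z2 ::
    "'a cstar_algebra \<Rightarrow> ('a \<Rightarrow> 'a) \<Rightarrow> 'd cstar_algebra \<Rightarrow> ('a \<Rightarrow> 'd) \<Rightarrow> 'd \<Rightarrow> bool" where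
  "covariant_Z2 A \<sigma> D \<phi> V \<longleftrightarrow> covariant_Z A \<sigma> D \<phi> V \<and> V \<otimes>\<^bsub>D\<^esub> V = \<one>\<^bsub>D\<^esub>"

text \<open>
  \<open>crossed_product_Z A \<sigma> B \<iota> W\<close> says that the C*-algebra \<open>B\<close>, with the canonical map \<open>\<iota>\<close> of
  \<open>A\<close> into \<open>B\<close> and the canonical unitary \<open>W\<close>, is a model of the crossed product of \<open>A\<close> by the
  integers; similarly for the group of order two.

  A definition cannot quantify over types, so the test algebras \<open>D\<close> of the universal property
  range over all unital C*-algebras whose carrier is a set of elements of type \<open>nat \<Rightarrow> 'a\<close>.
  This loses nothing.  If \<open>(\<phi>, V)\<close> is a covariant pair in a C*-algebra of any type, then the
  C*-subalgebra generated by its values is the closure of the set of finite sums of elements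
  \<open>\<phi> a V\<^sup>n\<close>.  Choosing for each of its elements a sequence of such sums converging to it injects
  the subalgebra into \<open>nat \<Rightarrow> int \<Rightarrow> 'a\<close>, hence into \<open>nat \<Rightarrow> 'a\<close>, and its structure can be
  transported along the injection.

  Uniqueness of the induced homomorphism follows from the generation clause.
\<close>

definition crossed_product_Z ::
    "'a cstar_algebra \<Rightarrow> ('a \<Rightarrow> 'a) \<Rightarrow> 'b cstar_algebra \<Rightarrow> ('a \<Rightarrow> 'b) \<Rightarrow> 'b \<Rightarrow> bool" where
  "crossed_product_Z A \<sigma> B \<iota> W \<longleftrightarrow>
     unital_cstar_algebra B \<and> covariant_Z A \<sigma> B \<iota> W \<and>
     cstar_generated_by B (\<iota> ` carrier A \<union> {W}) \<and>
     (\<forall>(D :: (nat \<Rightarrow> 'a) cstar_algebra) \<phi> V. unital_cstar_algebra D \<and> covariant_Z A \<sigma> D \<phi> V \<longrightarrow>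
        (\<exists>\<Phi>\<in>unital_star_hom B D. (\<forall>a\<in>carrier A. \<Phi> (\<iota> a) = \<phi> a) \<and> \<Phi> W = V))"

definition crossed_product_Z2 ::
    "'a cstar_algebra \<Rightarrow> ('a \<Rightarrow> 'a) \<Rightarrow> 'b cstar_algebra \<Rightarrow> ('a \<Rightarrow> 'b) \<Rightarrow> 'b \<Rightarrow> bool" where
  "crossed_product_Z2 A \<sigma> B \<iota> W \<longleftrightarrow>
     unital_cstar_algebra B \<and> covariant_Z2 A \<sigma> B \<iota> W \<and>
     cstar_generated_by B (\<iota> ` carrier A \<union> {W}) \<and>
     (\<forall>(D :: (nat \<Rightarrow> 'a) cstar_algebra) \<phi> V. unital_cstar_algebra D \<and> covariant_Z2 A \<sigma> D \<phi> V \<longrightarrow>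
        (\<exists>\<Phi>\<in>unital_star_hom B D. (\<forall>a\<in>carrier A. \<Phi> (\<iota> a) = \<phi> a) \<and> \<Phi> W = V))"


section \<open>Representations on Hilbert spaces\<close>

text \<open>
  The real inner product is the real part of \<open>cinner\<close>, so the library's norm is the Hilbert norm.
  \<open>cinner\<close> is linear in the first argument.
\<close>

class complex_hilbert_space = real_inner + banach +
  fixes scaleC :: "complex \<Rightarrow> 'a \<Rightarrow> 'a" (infixr \<open>*\<^sub>C\<close> 75)
    and cinner :: "'a \<Rightarrow> 'a \<Rightarrow> complex"
  assumes scaleC_add_right: "c *\<^sub>C (x + y) = c *\<^sub>C x + c *\<^sub>C y"
    and scaleC_add_left: "(c + d) *\<^sub>C x = c *\<^sub>C x + d *\<^sub>C x"
    and scaleC_scaleC: "c *\<^sub>C d *\<^sub>C x = (c * d) *\<^sub>C x"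
    and scaleC_of_real: "complex_of_real r *\<^sub>C x = r *\<^sub>R x"
    and cinner_commute: "cinner x y = cnj (cinner y x)"
    and cinner_add_left: "cinner (x + y) z = cinner x z + cinner y z"
    and cinner_scaleC_left: "cinner (c *\<^sub>C x) y = c * cinner x y"
    and Re_cinner: "Re (cinner x y) = inner x y"

definition bounded_clinear :: "('h::complex_hilbert_space \<Rightarrow> 'h) \<Rightarrow> bool" where
  "bounded_clinear f \<longleftrightarrow> bounded_linear f \<and> (\<forall>c x. f (c *\<^sub>C x) = c *\<^sub>C f x)"

text \<open>The last clause says that the adjoint of \<open>\<pi> x\<close> is \<open>\<pi>\<close> applied to the star of \<open>x\<close>.\<close>

definition representation ::
    "'b cstar_algebra \<Rightarrow> ('b \<Rightarrow> 'h::complex_hilbert_space \<Rightarrow> 'h) \<Rightarrow> bool" where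
  "representation B \<pi> \<longleftrightarrow>
     (\<exists>\<xi>::'h. \<xi> \<noteq> 0) \<and>
     (\<forall>x\<in>carrier B. bounded_clinear (\<pi> x)) \<and>
     \<pi> \<one>\<^bsub>B\<^esub> = id \<and>
     (\<forall>x\<in>carrier B. \<forall>y\<in>carrier B. \<pi> (x \<oplus>\<^bsub>B\<^esub> y) = (\<lambda>\<xi>. \<pi> x \<xi> + \<pi> y \<xi>)) \<and>
     (\<forall>c. \<forall>x\<in>carrier B. \<pi> (c \<odot>\<^bsub>B\<^esub> x) = (\<lambda>\<xi>. c *\<^sub>C \<pi> x \<xi>)) \<and>
     (\<forall>x\<in>carrier B. \<forall>y\<in>carrier B. \<pi> (x \<otimes>\<^bsub>B\<^esub> y) = \<pi> x \<circ> \<pi> y) \<and>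
     (\<forall>x\<in>carrier B. \<forall>\<xi> \<eta>. cinner (\<pi> x \<xi>) \<eta> = cinner \<xi> (\<pi> (star B x) \<eta>))"

definition irreducible_representation ::
    "'b cstar_algebra \<Rightarrow> ('b \<Rightarrow> 'h::complex_hilbert_space \<Rightarrow> 'h) \<Rightarrow> bool" where
  "irreducible_representation B \<pi> \<longleftrightarrow>
     representation B \<pi> \<and>
     (\<forall>M. closed M \<and> subspace M \<and> (\<forall>c. \<forall>\<xi>\<in>M. c *\<^sub>C \<xi> \<in> M) \<and>
          (\<forall>x\<in>carrier B. \<forall>\<xi>\<in>M. \<pi> x \<xi> \<in> M) \<longrightarrow> M = {0} \<or> M = UNIV)"

end

theory Submission
  imports Defs "HOL-Analysis.Bounded_Linear_Function"
begin

text \<open>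
  A unitary \<open>V\<close> on the Hilbert space that implements \<open>\<sigma>\<close> and has scalar square makes the operators
  \<open>\<phi> a + \<phi> b V\<close> a *-algebra; its norm closure is a C*-algebra on which the universal property of
  either crossed product can be tested.  This extends \<open>z \<pi>\<^sub>2(W)\<close> to the crossed product by the
  integers.  Conversely, in an irreducible representation of the latter, the square of the canonical
  unitary commutes with everything because \<open>\<sigma>\<^sup>2 = id\<close>, so by Schur's lemma it is a scalar \<open>z\<^sup>2\<close>, and
  dividing the unitary by \<open>z\<close> gives a covariant pair for the group of order two.

  Representations are contractive: if \<open>\<parallel>x\<parallel> < r = \<parallel>\<pi> x\<parallel>\<close>, then \<open>1 - x\<^sup>* x / r\<^sup>2\<close> is left invertible by a
  Neumann series, whereas \<open>1 - (\<pi> x)\<^sup>* (\<pi> x) / r\<^sup>2\<close> is not bounded below.  Hence identities between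
  representations need only be checked on generators.
\<close>

section \<open>Adjointable operators on a Hilbert space\<close>

text \<open>The test algebras of the universal properties have carriers in
  \<open>nat \<Rightarrow> 'a\<close>, but the operators live on an unrelated space. So the
  C*-algebra generated by a covariant pair is copied into sequences over \<open>A\<close>, and the
  homomorphism obtained there is decoded into operators.

  A scalar square is what keeps this manageable: every word in the images of \<open>A\<close> and in
  \<open>V\<close> reduces to two coefficients, and the adjoint of \<open>V\<close> is a multiple of
  \<open>V\<close>, so neither higher nor negative powers occur. The same fact transfers
  irreducibility: the two canonical unitaries differ by a nonzero scalar, so the two representations
  have the same closed invariant subspaces.

  Schur's lemma is derived from a square root built by a norm-convergent iteration. What matters
  about this root is that everything commuting with the given operator also commutes with the root,
  a property that passes to limits.\<close>

lemma cinner_add_right: "cinner x (y + z) = cinner x y + cinner x z"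
  by (metis cinner_add_left cinner_commute complex_cnj_add)

lemma cinner_scaleC_right: "cinner x (c *\<^sub>C y) = cnj c * cinner x y"
  by (metis cinner_scaleC_left cinner_commute complex_cnj_mult)

lemma cinner_diff_left: "cinner (x - y) z = cinner x z - cinner y z"
  using cinner_add_left[of "x - y" y z] by simp

lemma cinner_diff_right: "cinner x (y - z) = cinner x y - cinner x z"
  using cinner_add_right[of x "y - z" z] by simp

lemma cinner_zero_left: "cinner 0 x = 0"
  using cinner_diff_left[of x x x] by simp

lemma cinner_zero_right: "cinner x 0 = 0"
  using cinner_diff_right[of x x x] by simp

lemma cinner_eqI:
  assumes "\<And>z. cinner x z = cinner y z"
  shows "x = y"
proof -
  have "inner (x - y) (x - y) = 0"
    by (metis Re_cinner assms diff_self inner_diff_left)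
  then show ?thesis by simp
qed

lemma scaleC_one: "1 *\<^sub>C x = x"
  using scaleC_of_real[of 1 x] by simp

lemma norm_scaleC: "norm (c *\<^sub>C x) = cmod c * norm x"
proof -
  have "(norm (c *\<^sub>C x))\<^sup>2 = Re ((c * cnj c) * cinner x x)"
    by (simp add: power2_norm_eq_inner flip: Re_cinner)
      (simp add: cinner_scaleC_left cinner_scaleC_right algebra_simps)
  also have "\<dots> = (cmod c * norm x)\<^sup>2"
    by (simp add: complex_norm_square[symmetric] Re_cinner power2_norm_eq_inner power_mult_distrib
        flip: of_real_power)
  finally show ?thesis by (simp add: power2_eq_iff_nonneg)
qed

lemma bounded_linear_scaleC: "bounded_linear (\<lambda>x. c *\<^sub>C x)"
proof (rule bounded_linear_intro[of _ "cmod c"])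
  show "c *\<^sub>C (r *\<^sub>R x) = r *\<^sub>R c *\<^sub>C x" for r and x :: 'a
    by (simp add: scaleC_scaleC mult.commute flip: scaleC_of_real)
qed (simp_all add: scaleC_add_right norm_scaleC)

lemmas linear_scaleC = bounded_linear.linear[OF bounded_linear_scaleC]

text \<open>A bounded operator of this type is a priori only real-linear. A complex multiple of an
  operator is written as a composition with \<open>cscale c\<close>, and commuting with all
  \<open>cscale c\<close> is complex linearity.\<close>

lift_definition cscale :: "complex \<Rightarrow> 'h::complex_hilbert_space \<Rightarrow>\<^sub>L 'h" is "\<lambda>c x. c *\<^sub>C x"
  by (rule bounded_linear_scaleC)

declare cscale.rep_eq [simp]

section \<open>Adjoints of bounded operators\<close>

definition is_adjoint :: "('h::complex_hilbert_space \<Rightarrow>\<^sub>L 'h) \<Rightarrow> ('h \<Rightarrow>\<^sub>L 'h) \<Rightarrow> bool" where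
  "is_adjoint T S \<longleftrightarrow> (\<forall>x y. cinner (T x) y = cinner x (S y))"

lemma is_adjoint_sym: "is_adjoint T S \<Longrightarrow> is_adjoint S T"
  unfolding is_adjoint_def by (metis cinner_commute)

lemma is_adjoint_unique: "is_adjoint T S \<Longrightarrow> is_adjoint T S' \<Longrightarrow> S = S'"
proof (rule blinfun_eqI)
  fix x assume "is_adjoint T S" "is_adjoint T S'"
  then show "S x = S' x"
    by (intro cinner_eqI) (metis is_adjoint_sym is_adjoint_def)
qed

text \<open>The scalar can be pulled out of the first argument of \<open>cinner\<close> on the other
  side of the adjoint identity, so an adjoint forces complex linearity.\<close>

lemma is_adjoint_clinear: "is_adjoint T S \<Longrightarrow> T (c *\<^sub>C x) = c *\<^sub>C T x"
  by (rule cinner_eqI) (simp add: is_adjoint_def cinner_scaleC_left)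

lemma is_adjoint_id: "is_adjoint id_blinfun id_blinfun"
  by (simp add: is_adjoint_def)

lemma is_adjoint_zero: "is_adjoint 0 0"
  by (simp add: is_adjoint_def cinner_zero_left cinner_zero_right)

lemma is_adjoint_plus: "is_adjoint T S \<Longrightarrow> is_adjoint T' S' \<Longrightarrow> is_adjoint (T + T') (S + S')"
  by (simp add: is_adjoint_def blinfun.add_left cinner_add_left cinner_add_right)

lemma is_adjoint_cscale: "is_adjoint (cscale c) (cscale (cnj c))"
  by (simp add: is_adjoint_def cinner_scaleC_left cinner_scaleC_right)

lemma is_adjoint_compose:
  "is_adjoint T S \<Longrightarrow> is_adjoint T' S' \<Longrightarrow> is_adjoint (T o\<^sub>L T') (S' o\<^sub>L S)"
  by (simp add: is_adjoint_def)

lemma is_adjoint_cscale_commute: "is_adjoint T S \<Longrightarrow> T o\<^sub>L cscale c = cscale c o\<^sub>L T"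
  by (rule blinfun_eqI) (simp add: is_adjoint_clinear)

lemma is_adjoint_cscale_compose:
  "is_adjoint T S \<Longrightarrow> is_adjoint (cscale c o\<^sub>L T) (cscale (cnj c) o\<^sub>L S)"
  by (metis is_adjoint_compose is_adjoint_cscale is_adjoint_cscale_commute is_adjoint_sym)

text \<open>The upper bound holds for every scalar; applied to \<open>inverse c\<close> it gives the
  lower bound.\<close>

lemma norm_cscale_compose: "norm (cscale c o\<^sub>L T) = cmod c * norm T"
proof -
  have le: "norm (cscale c o\<^sub>L T) \<le> cmod c * norm T" for c and T :: "'a \<Rightarrow>\<^sub>L 'b"
    by (rule norm_blinfun_bound)
      (simp_all add: norm_scaleC mult.assoc mult_left_mono norm_blinfun)
  show ?thesis
  proof (cases "c = 0")
    case True
    then show ?thesis using le[of c T] by simp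
  next
    case False
    have "cscale (inverse c) o\<^sub>L (cscale c o\<^sub>L T) = T"
      using False by (intro blinfun_eqI) (simp add: scaleC_scaleC scaleC_one)
    then have "norm T \<le> cmod (inverse c) * norm (cscale c o\<^sub>L T)"
      using le[of "inverse c" "cscale c o\<^sub>L T"] by simp
    then have "cmod c * norm T \<le> norm (cscale c o\<^sub>L T)"
      using False by (simp add: norm_divide field_simps)
    then show ?thesis using le[of c T] by simp
  qed
qed

text \<open>Cauchy-Schwarz bounds |S x|^2 = <T (S x), x> by |T| |S x| |x|, and one factor |S x|
  cancels.\<close>

lemma norm_is_adjoint_le:
  assumes "is_adjoint T S"
  shows "norm S \<le> norm T"
proof (rule norm_blinfun_bound)
  fix x
  have "norm (S x) * norm (S x) = inner (S x) (S x)"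
    by (metis power2_eq_square power2_norm_eq_inner)
  also have "\<dots> = inner (T (S x)) x"
    using assms by (simp add: is_adjoint_def flip: Re_cinner)
  also have "\<dots> \<le> norm (T (S x)) * norm x"
    by (rule norm_cauchy_schwarz)
  also have "\<dots> \<le> norm T * norm (S x) * norm x"
    by (simp add: mult_right_mono norm_blinfun)
  finally have "norm (S x) * norm (S x) \<le> norm (S x) * (norm T * norm x)"
    by (simp add: algebra_simps)
  then show "norm (S x) \<le> norm T * norm x"
    by (cases "norm (S x) = 0") (auto dest: mult_left_le_imp_le)
qed simp

lemma norm_is_adjoint: "is_adjoint T S \<Longrightarrow> norm S = norm T"
  by (meson antisym is_adjoint_sym norm_is_adjoint_le)

text \<open>The lower bound comes from |T x|^2 = <x, S (T x)>. This is the C*-identity of the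
  operator algebra.\<close>

lemma norm_adjoint_compose:
  assumes "is_adjoint T S"
  shows "norm (S o\<^sub>L T) = (norm T)\<^sup>2"
proof (rule antisym)
  show "norm (S o\<^sub>L T) \<le> (norm T)\<^sup>2"
    using norm_blinfun_compose[of S T] norm_is_adjoint[OF assms] by (simp add: power2_eq_square)
  have "norm (T x) \<le> sqrt (norm (S o\<^sub>L T)) * norm x" for x
  proof -
    have "(norm (T x))\<^sup>2 = inner x ((S o\<^sub>L T) x)"
      using assms by (simp add: is_adjoint_def power2_norm_eq_inner flip: Re_cinner)
    also have "\<dots> \<le> norm x * norm ((S o\<^sub>L T) x)"
      by (rule norm_cauchy_schwarz)
    also have "\<dots> \<le> norm x * (norm (S o\<^sub>L T) * norm x)"
      by (intro mult_left_mono norm_blinfun) simp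
    also have "\<dots> = (sqrt (norm (S o\<^sub>L T)) * norm x)\<^sup>2"
      by (simp add: power2_eq_square)
    finally show ?thesis by (rule power2_le_imp_le) simp
  qed
  then have "norm T \<le> sqrt (norm (S o\<^sub>L T))"
    by (intro norm_blinfun_bound) auto
  then show "(norm T)\<^sup>2 \<le> norm (S o\<^sub>L T)"
    by (metis norm_ge_zero power_mono real_sqrt_pow2)
qed

lemma is_adjoint_minus: "is_adjoint T S \<Longrightarrow> is_adjoint T' S' \<Longrightarrow> is_adjoint (T - T') (S - S')"
  by (simp add: is_adjoint_def blinfun.diff_left cinner_diff_left cinner_diff_right)

lemma is_adjoint_tendsto:
  assumes "T \<longlonglongrightarrow> t" "S \<longlonglongrightarrow> s" "\<And>n. is_adjoint (T n) (S n)"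
  shows "is_adjoint t s"
  unfolding is_adjoint_def
proof (intro allI)
  fix x y
  have inner_lim: "inner (t x) y = inner x (s y)" for x y
  proof (rule LIMSEQ_unique)
    show "(\<lambda>n. inner (T n x) y) \<longlonglongrightarrow> inner (t x) y"
      using assms(1) by (intro tendsto_intros)
    have "inner (T n x) y = inner x (S n y)" for n
      using assms(3) by (simp add: is_adjoint_def flip: Re_cinner)
    moreover have "(\<lambda>n. inner x (S n y)) \<longlonglongrightarrow> inner x (s y)"
      using assms(2) by (intro tendsto_intros)
    ultimately show "(\<lambda>n. inner (T n x) y) \<longlonglongrightarrow> inner x (s y)" by simp
  qed
  have comm: "t (c *\<^sub>C x) = c *\<^sub>C t x" for c
  proof (rule LIMSEQ_unique)
    show "(\<lambda>n. T n (c *\<^sub>C x)) \<longlonglongrightarrow> t (c *\<^sub>C x)"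
      using assms(1) by (intro tendsto_intros)
    have "(\<lambda>n. cscale c (T n x)) \<longlonglongrightarrow> cscale c (t x)"
      using assms(1) by (intro tendsto_intros)
    then show "(\<lambda>n. T n (c *\<^sub>C x)) \<longlonglongrightarrow> c *\<^sub>C t x"
      using is_adjoint_clinear[OF assms(3)] by simp
  qed
  \<comment> \<open>The limit argument runs in the real inner product. The imaginary part is
    recovered from it by multiplying a vector by \<i>, and \<open>comm\<close> moves that factor
    through \<open>t\<close>.\<close>
  have Im: "Im (cinner u v) = - inner (\<i> *\<^sub>C u) v" for u v :: 'a
    by (simp add: cinner_scaleC_left flip: Re_cinner)
  show "cinner (t x) y = cinner x (s y)"
  proof (rule complex_eqI)
    show "Re (cinner (t x) y) = Re (cinner x (s y))"
      by (simp add: Re_cinner inner_lim)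
    show "Im (cinner (t x) y) = Im (cinner x (s y))"
      by (simp add: Im inner_lim flip: comm)
  qed
qed

section \<open>The C*-algebra of adjointable operators\<close>

definition adjointable :: "('h::complex_hilbert_space \<Rightarrow>\<^sub>L 'h) set" where
  "adjointable = {T. \<exists>S. is_adjoint T S}"

definition operator_adjoint :: "('h::complex_hilbert_space \<Rightarrow>\<^sub>L 'h) \<Rightarrow> 'h \<Rightarrow>\<^sub>L 'h" where
  "operator_adjoint T = (SOME S. is_adjoint T S)"

lemma is_adjoint_adjoint: "T \<in> adjointable \<Longrightarrow> is_adjoint T (operator_adjoint T)"
  unfolding adjointable_def operator_adjoint_def by (auto intro: someI)

lemma adjoint_eqI: "is_adjoint T S \<Longrightarrow> operator_adjoint T = S"
  by (metis operator_adjoint_def is_adjoint_unique someI)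

lemma adjointableI: "is_adjoint T S \<Longrightarrow> T \<in> adjointable"
  by (auto simp: adjointable_def)

lemma adjointable_id: "id_blinfun \<in> adjointable"
  using is_adjoint_id by (rule adjointableI)

lemma adjointable_zero: "0 \<in> adjointable"
  using is_adjoint_zero by (rule adjointableI)

lemma adjointable_plus: "T \<in> adjointable \<Longrightarrow> S \<in> adjointable \<Longrightarrow> T + S \<in> adjointable"
  using is_adjoint_plus unfolding adjointable_def by blast

lemma adjointable_compose: "T \<in> adjointable \<Longrightarrow> S \<in> adjointable \<Longrightarrow> T o\<^sub>L S \<in> adjointable"
  using is_adjoint_compose unfolding adjointable_def by blast

lemma dist_adjoint:
  "T \<in> adjointable \<Longrightarrow> T' \<in> adjointable \<Longrightarrow> dist (operator_adjoint T) (operator_adjoint T') = dist T T'"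
  by (simp add: dist_norm is_adjoint_adjoint is_adjoint_minus norm_is_adjoint)

text \<open>Taking adjoints is isometric, so the adjoints of a convergent sequence are Cauchy. This
  makes \<open>adjointable\<close> norm closed, hence complete.\<close>

lemma adjointable_tendsto:
  assumes "T \<longlonglongrightarrow> t" "\<And>n. T n \<in> adjointable"
  shows "t \<in> adjointable" "(\<lambda>n. operator_adjoint (T n)) \<longlonglongrightarrow> operator_adjoint t"
proof -
  have "Cauchy T" using assms(1) by (rule LIMSEQ_imp_Cauchy)
  then have "Cauchy (\<lambda>n. operator_adjoint (T n))"
    using assms(2) by (simp add: Cauchy_def dist_adjoint)
  then obtain s where s: "(\<lambda>n. operator_adjoint (T n)) \<longlonglongrightarrow> s"
    by (metis Cauchy_convergent convergent_def)
  then have "is_adjoint t s"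
    using assms by (intro is_adjoint_tendsto[OF assms(1) s] is_adjoint_adjoint)
  with s show "t \<in> adjointable" "(\<lambda>n. operator_adjoint (T n)) \<longlonglongrightarrow> operator_adjoint t"
    by (auto intro: adjointableI simp: adjoint_eqI)
qed

text \<open>By Riesz representation the adjointable operators are exactly the bounded complex-linear
  ones, so this is B(H).\<close>

definition operator_algebra :: "('h::complex_hilbert_space \<Rightarrow>\<^sub>L 'h) cstar_algebra" where
  "operator_algebra =
     \<lparr>carrier = adjointable, monoid.mult = (o\<^sub>L), one = id_blinfun, zero = 0, add = (+),
      smult = \<lambda>c T. cscale c o\<^sub>L T, star = operator_adjoint, cnorm = norm\<rparr>"

lemma operator_algebra_simps [simp]:
  "carrier operator_algebra = adjointable"
  "monoid.mult operator_algebra = (o\<^sub>L)"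
  "one operator_algebra = id_blinfun"
  "zero operator_algebra = 0"
  "add operator_algebra = (+)"
  "smult operator_algebra = (\<lambda>c T. cscale c o\<^sub>L T)"
  "star operator_algebra = operator_adjoint"
  "cnorm operator_algebra = norm"
  by (simp_all add: operator_algebra_def)

lemma ring_operator_algebra: "ring operator_algebra" (is "ring ?A")
proof (rule ringI)
  show "abelian_group ?A"
  proof (rule abelian_groupI)
    fix T :: "'a \<Rightarrow>\<^sub>L 'a" assume "T \<in> carrier ?A"
    then have "is_adjoint (0 - T) (0 - operator_adjoint T)"
      by (simp add: is_adjoint_minus is_adjoint_zero is_adjoint_adjoint del: diff_0)
    then show "\<exists>S\<in>carrier ?A. S \<oplus>\<^bsub>?A\<^esub> T = \<zero>\<^bsub>?A\<^esub>"
      by (intro bexI[of _ "0 - T"]) (simp_all add: adjointableI)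
  qed (simp_all add: adjointable_zero adjointable_plus add_ac)
  show "monoid ?A"
    by (rule monoidI) (simp_all add: adjointable_id adjointable_compose blinfun_eqI)
qed (simp_all add: blinfun_eqI blinfun.bilinear_simps)

lemma operator_algebra_minus:
  assumes "T \<in> adjointable" "S \<in> adjointable"
  shows "T \<ominus>\<^bsub>operator_algebra\<^esub> S = T - S"
proof -
  interpret ring operator_algebra by (rule ring_operator_algebra)
  have "is_adjoint (0 - S) (0 - operator_adjoint S)"
    using assms by (simp add: is_adjoint_minus is_adjoint_zero is_adjoint_adjoint del: diff_0)
  then have "\<ominus>\<^bsub>operator_algebra\<^esub> S = - S"
    using assms by (intro minus_equality) (auto dest: adjointableI)
  then show ?thesis by (simp add: minus_eq)
qed

lemma unital_cstar_operator_algebra: "unital_cstar_algebra operator_algebra"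
proof -
  have compl: "\<exists>x\<in>carrier operator_algebra.
      (\<lambda>n. cnorm operator_algebra (f n \<ominus>\<^bsub>operator_algebra\<^esub> x)) \<longlonglongrightarrow> 0"
    if f: "\<forall>n::nat. f n \<in> carrier operator_algebra"
      and C: "\<forall>e>0. \<exists>N. \<forall>m\<ge>N. \<forall>n\<ge>N.
        cnorm operator_algebra (f m \<ominus>\<^bsub>operator_algebra\<^esub> f n) < e"
    for f :: "nat \<Rightarrow> 'a \<Rightarrow>\<^sub>L 'a"
  proof -
    have "Cauchy f"
      using f C by (auto simp: Cauchy_def dist_norm operator_algebra_minus)
    then obtain x where x: "f \<longlonglongrightarrow> x"
      by (metis Cauchy_convergent convergent_def)
    moreover have "x \<in> adjointable"
      using adjointable_tendsto(1)[OF x] f by simp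
    ultimately show ?thesis
      using f by (auto intro!: bexI[of _ x] tendsto_norm_zero simp: operator_algebra_minus LIM_zero)
  qed
  have adj: "T \<in> adjointable \<Longrightarrow> is_adjoint T (operator_adjoint T)" for T :: "'a \<Rightarrow>\<^sub>L 'a"
    by (rule is_adjoint_adjoint)
  \<comment> \<open>The star laws all come from one source: an explicit adjoint can be written down,
    and adjoints are unique.\<close>
  have star_mult: "operator_adjoint (S o\<^sub>L T) = operator_adjoint T o\<^sub>L operator_adjoint S"
    and star_add: "operator_adjoint (S + T) = operator_adjoint S + operator_adjoint T"
    and star_smult: "operator_adjoint (cscale c o\<^sub>L T) = cscale (cnj c) o\<^sub>L operator_adjoint T"
    and star_star: "operator_adjoint (operator_adjoint T) = T"
    and star_closed: "operator_adjoint T \<in> adjointable"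
    and smult_closed: "cscale c o\<^sub>L T \<in> adjointable"
    and cstar: "norm (operator_adjoint T o\<^sub>L T) = (norm T)\<^sup>2"
    and linear: "S o\<^sub>L (cscale c o\<^sub>L T) = cscale c o\<^sub>L (S o\<^sub>L T)"
    if "S \<in> adjointable" "T \<in> adjointable" for S T :: "'a \<Rightarrow>\<^sub>L 'a" and c
    using that[THEN adj]
    by (blast intro: adjoint_eqI adjointableI is_adjoint_sym is_adjoint_plus is_adjoint_compose
        is_adjoint_cscale_compose norm_adjoint_compose,
        (blast intro: adjoint_eqI adjointableI is_adjoint_sym is_adjoint_plus is_adjoint_compose
        is_adjoint_cscale_compose norm_adjoint_compose)+,
        simp add: blinfun_eqI is_adjoint_clinear)
  have module: "cscale (c + d) o\<^sub>L T = (cscale c o\<^sub>L T) + (cscale d o\<^sub>L T)"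
    "cscale c o\<^sub>L (S + T) = (cscale c o\<^sub>L S) + (cscale c o\<^sub>L T)"
    "cscale (c * d) o\<^sub>L T = cscale c o\<^sub>L (cscale d o\<^sub>L T)"
    "cscale 1 o\<^sub>L T = T"
    "(cscale c o\<^sub>L S) o\<^sub>L T = cscale c o\<^sub>L (S o\<^sub>L T)" for S T :: "'a \<Rightarrow>\<^sub>L 'a" and c d
    by (rule blinfun_eqI, simp add: blinfun.bilinear_simps scaleC_add_left scaleC_add_right
        scaleC_scaleC scaleC_one)+
  show ?thesis
    by (intro unital_cstar_algebra.intro ring_operator_algebra
        unital_cstar_algebra_axioms.intro compl)
      (simp_all add: star_mult star_add star_smult star_star star_closed smult_closed cstar linear
        module norm_cscale_compose norm_triangle_ineq norm_blinfun_compose)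
qed

section \<open>Abstract C*-algebras\<close>

context unital_cstar_algebra
begin

lemma smult_zero_left: "x \<in> carrier A \<Longrightarrow> 0 \<odot> x = \<zero>"
  by (metis add.l_cancel_one add_0 smult_closed smult_l_distr)

lemma smult_minus_one: "x \<in> carrier A \<Longrightarrow> (- 1) \<odot> x = \<ominus> x"
  by (metis add.left_inverse minus_equality smult_closed smult_l_distr smult_one smult_zero_left)

lemma minus_eq_smult: "x \<in> carrier A \<Longrightarrow> y \<in> carrier A \<Longrightarrow> x \<ominus> y = x \<oplus> (- 1) \<odot> y"
  by (simp add: minus_eq smult_minus_one)

lemma cnorm_uminus: "x \<in> carrier A \<Longrightarrow> cnorm A (\<ominus> x) = cnorm A x"
  using cnorm_smult[of x "- 1"] by (simp add: smult_minus_one)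

lemma cnorm_zero: "cnorm A \<zero> = 0"
  by (simp add: cnorm_eq_zero)

lemma cnorm_minus_commute: "x \<in> carrier A \<Longrightarrow> y \<in> carrier A \<Longrightarrow> cnorm A (x \<ominus> y) = cnorm A (y \<ominus> x)"
  by (metis a_inv_closed cnorm_uminus minus_add minus_closed minus_eq minus_minus a_comm)

text \<open>Submultiplicativity in the C*-identity gives one inequality for every element; for
  \<open>star A x\<close> it is the reverse one.\<close>

lemma cnorm_star: "x \<in> carrier A \<Longrightarrow> cnorm A (star A x) = cnorm A x"
proof -
  have le: "cnorm A y \<le> cnorm A (star A y)" if y: "y \<in> carrier A" for y
  proof (cases "cnorm A y = 0")
    case True
    then show ?thesis using y by (simp add: cnorm_nonneg star_closed)
  next
    case False
    have "cnorm A y * cnorm A y \<le> cnorm A (star A y) * cnorm A y"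
      using y cstar_identity[OF y] cnorm_mult[of "star A y" y]
      by (simp add: star_closed power2_eq_square)
    then show ?thesis
      using False cnorm_nonneg[OF y] by simp
  qed
  assume "x \<in> carrier A"
  then show ?thesis
    using le[of x] le[of "star A x"] by (simp add: star_closed star_star)
qed

lemma star_minus: "x \<in> carrier A \<Longrightarrow> y \<in> carrier A \<Longrightarrow> star A (x \<ominus> y) = star A x \<ominus> star A y"
  by (simp add: minus_eq_smult star_add star_smult smult_closed star_closed)

lemma star_one: "star A \<one> = \<one>"
  by (metis one_closed r_one star_closed star_mult star_star)

text \<open>The star has to be treated for generators only: the induction runs on the set of those
  elements at which \<open>P\<close> holds together with their stars, and this set is a
  C*-subalgebra because the star is isometric and reverses products.\<close>

lemma generated_induct [consumes 2, case_names generator star one add mult smult limit]: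
  assumes "cstar_generated_by A G" "x \<in> carrier A"
    and generator: "\<And>x. x \<in> G \<Longrightarrow> P x" and star: "\<And>x. x \<in> G \<Longrightarrow> P (star A x)"
    and one: "P \<one>"
    and add: "\<And>x y. \<lbrakk>x \<in> carrier A; y \<in> carrier A; P x; P y\<rbrakk> \<Longrightarrow> P (x \<oplus> y)"
    and mult: "\<And>x y. \<lbrakk>x \<in> carrier A; y \<in> carrier A; P x; P y\<rbrakk> \<Longrightarrow> P (x \<otimes> y)"
    and smult: "\<And>c x. \<lbrakk>x \<in> carrier A; P x\<rbrakk> \<Longrightarrow> P (c \<odot> x)"
    and limit: "\<And>x. \<lbrakk>x \<in> carrier A; \<And>e. e > 0 \<Longrightarrow> \<exists>y\<in>carrier A. P y \<and> cnorm A (x \<ominus> y) < e\<rbrakk> \<Longrightarrow> P x"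
  shows "P x"
proof -
  define S where "S = {x \<in> carrier A. P x \<and> P (star A x)}"
  have "unital_cstar_subalgebra A S"
    unfolding unital_cstar_subalgebra_def
  proof (intro conjI ballI impI allI)
    fix x assume x: "x \<in> carrier A" and "\<forall>e>0. \<exists>y\<in>S. cnorm A (x \<ominus> y) < e"
    then have near: "\<exists>y\<in>carrier A. P y \<and> P (star A y) \<and> cnorm A (x \<ominus> y) < e" if "e > 0" for e
      using that unfolding S_def by fastforce
    have "P x"
      using x near by (intro limit) blast+
    moreover have "P (star A x)"
    proof (rule limit)
      fix e :: real assume "e > 0"
      then obtain y where "y \<in> carrier A" "P (star A y)" "cnorm A (x \<ominus> y) < e"
        using near by blast
      then show "\<exists>y\<in>carrier A. P y \<and> cnorm A (star A x \<ominus> y) < e"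
        using x by (intro bexI[of _ "star A y"])
          (simp_all add: star_closed cnorm_star flip: star_minus)
    qed (use x star_closed in auto)
    ultimately show "x \<in> S" using x by (simp add: S_def)
  qed (auto simp: S_def one star_one star_add star_mult star_smult star_star
      intro: add mult smult star_closed smult_closed)
  moreover have "G \<subseteq> S"
    using assms(1) generator star by (auto simp: S_def cstar_generated_by_def)
  ultimately have "S = carrier A"
    using assms(1) by (auto simp: cstar_generated_by_def)
  then show ?thesis
    using assms(2) by (auto simp: S_def)
qed

text \<open>The left inverse is the fixed point of the contraction \<open>y \<mapsto> \<one> \<oplus> y \<otimes> h\<close>.\<close>

lemma left_inverse_near_one:
  assumes h: "h \<in> carrier A" and less: "cnorm A h < 1"
  obtains y where "y \<in> carrier A" "y \<otimes> (\<one> \<ominus> h) = \<one>"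
proof -
  define q where "q = cnorm A h"
  have q: "0 \<le> q" "q < 1" using h less by (simp_all add: q_def cnorm_nonneg)
  define s where "s = rec_nat \<zero> (\<lambda>_ y. \<one> \<oplus> y \<otimes> h)"
  have s_0: "s 0 = \<zero>" and s_Suc: "s (Suc n) = \<one> \<oplus> s n \<otimes> h" for n
    by (simp_all add: s_def)
  have s: "s n \<in> carrier A" for n
    by (induction n) (simp_all add: s_0 s_Suc h)
  \<comment> \<open>\<open>K\<close> is the sum of the geometric series |1| q^n, so a bound by
    \<open>K\<close> survives an iteration step. The norm of the unit is kept because it is zero in
    the zero algebra.\<close>
  define K where "K = cnorm A \<one> / (1 - q)"
  have K: "0 \<le> K" "cnorm A \<one> + K * q = K"
    using q by (simp_all add: K_def cnorm_nonneg field_simps)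
  have mult_h: "cnorm A (x \<otimes> h) \<le> r * q" if "x \<in> carrier A" "cnorm A x \<le> r" for x r
    using cnorm_mult[OF that(1) h] mult_right_mono[OF that(2) q(1)] by (simp add: q_def)
  have bound: "cnorm A (s n) \<le> K" for n
  proof (induction n)
    case (Suc n)
    have "cnorm A (s (Suc n)) \<le> cnorm A \<one> + cnorm A (s n \<otimes> h)"
      by (simp add: s_Suc cnorm_triangle s h)
    also have "\<dots> \<le> cnorm A \<one> + K * q"
      using mult_h[OF s Suc] by simp
    finally show ?case using K by simp
  qed (simp add: s_0 cnorm_zero K)
  \<comment> \<open>The affine map sends a difference to that difference times \<open>h\<close>, so
    \<open>n\<close> steps shrink the bound \<open>K\<close> on \<open>s k \<ominus> s 0\<close> by
    the factor \<open>q ^ n\<close>.\<close>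
  have step: "s (Suc m) \<ominus> s (Suc n) = (s m \<ominus> s n) \<otimes> h" for m n
  proof -
    have "(\<one> \<oplus> a) \<ominus> (\<one> \<oplus> b) = a \<ominus> b" if "a \<in> carrier A" "b \<in> carrier A" for a b
      using that by algebra
    then show ?thesis
      using h s[of m] s[of n] by (simp add: s_Suc l_distr minus_eq l_minus)
  qed
  have diff: "cnorm A (s (n + k) \<ominus> s n) \<le> K * q ^ n" for n k
  proof (induction n)
    case 0
    have "s k \<ominus> \<zero> = s k" using s[of k] by algebra
    then show ?case using bound[of k] by (simp add: s_0)
  next
    case (Suc n)
    then show ?case
      using mult_h[OF _ Suc] s by (simp add: step mult.assoc mult.commute mult.left_commute)
  qed
  have small: "\<forall>\<^sub>F n in sequentially. K * q ^ n < e" if "e > 0" for e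
  proof -
    have "(\<lambda>n. K * q ^ n) \<longlonglongrightarrow> K * 0"
      using q by (intro tendsto_intros LIMSEQ_realpow_zero) auto
    then show ?thesis using that by (auto dest: order_tendstoD(2))
  qed
  have "\<forall>e>0. \<exists>N. \<forall>m\<ge>N. \<forall>n\<ge>N. cnorm A (s m \<ominus> s n) < e"
  proof (intro allI impI)
    fix e :: real assume "e > 0"
    then obtain N where N: "\<And>n. n \<ge> N \<Longrightarrow> K * q ^ n < e"
      using small[of e] by (auto simp: eventually_sequentially)
    have "cnorm A (s m \<ominus> s n) < e" if "m \<ge> N" "n \<ge> N" for m n
    proof (cases "n \<le> m")
      case True
      then show ?thesis using diff[of n "m - n"] N[of n] that by simp
    next
      case False
      then show ?thesis
        using diff[of m "n - m"] N[of m] that cnorm_minus_commute[OF s s, of m n] by simp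
    qed
    then show "\<exists>N. \<forall>m\<ge>N. \<forall>n\<ge>N. cnorm A (s m \<ominus> s n) < e" by blast
  qed
  then obtain y where y: "y \<in> carrier A" and lim: "(\<lambda>n. cnorm A (s n \<ominus> y)) \<longlonglongrightarrow> 0"
    using cnorm_complete[of s] s by blast
  \<comment> \<open>\<open>z\<close> is the image of the limit \<open>y\<close> under the iteration
    map. Both are limits of \<open>s (Suc n)\<close>, so y = z is a fixed point.\<close>
  define z where "z = \<one> \<oplus> y \<otimes> h"
  have z: "z \<in> carrier A" using y h by (simp add: z_def)
  have "cnorm A (y \<ominus> z) \<le> cnorm A (s (Suc n) \<ominus> y) + cnorm A (s n \<ominus> y) * q" for n
  proof -
    have "y \<ominus> z = (y \<ominus> s (Suc n)) \<oplus> (s (Suc n) \<ominus> z)"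
      using y z s[of "Suc n"] by algebra
    moreover have "s (Suc n) \<ominus> z = (s n \<ominus> y) \<otimes> h"
    proof -
      have "(\<one> \<oplus> a) \<ominus> (\<one> \<oplus> b) = a \<ominus> b" if "a \<in> carrier A" "b \<in> carrier A" for a b
        using that by algebra
      then show ?thesis
        using h s[of n] y by (simp add: s_Suc z_def l_distr minus_eq l_minus)
    qed
    ultimately have "cnorm A (y \<ominus> z) \<le> cnorm A (y \<ominus> s (Suc n)) + cnorm A ((s n \<ominus> y) \<otimes> h)"
      using cnorm_triangle[of "y \<ominus> s (Suc n)" "(s n \<ominus> y) \<otimes> h"] y s h by simp
    then show ?thesis
      using mult_h[of "s n \<ominus> y" "cnorm A (s n \<ominus> y)"] y s cnorm_minus_commute[OF y s, of "Suc n"]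
      by simp
  qed
  moreover have "(\<lambda>n. cnorm A (s (Suc n) \<ominus> y) + cnorm A (s n \<ominus> y) * q) \<longlonglongrightarrow> 0 + 0 * q"
    using lim by (intro tendsto_intros) (rule LIMSEQ_Suc)
  ultimately have "cnorm A (y \<ominus> z) \<le> 0"
    by (intro LIMSEQ_le_const[where X = "\<lambda>n. cnorm A (s (Suc n) \<ominus> y) + cnorm A (s n \<ominus> y) * q"]) auto
  then have "y \<ominus> z = \<zero>"
    using y z cnorm_nonneg[of "y \<ominus> z"] by (simp add: cnorm_eq_zero[symmetric])
  moreover have "y = (y \<ominus> z) \<oplus> z"
    using y z by algebra
  ultimately have "y = \<one> \<oplus> y \<otimes> h"
    using z by (simp add: z_def)
  moreover have "(\<one> \<oplus> a) \<ominus> a = \<one>" if "a \<in> carrier A" for a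
    using that by algebra
  ultimately have "y \<otimes> (\<one> \<ominus> h) = \<one>"
    using y h by (metis m_closed minus_eq one_closed r_distr r_minus r_one a_inv_closed)
  with y show thesis by (rule that)
qed

end

section \<open>Transport of a C*-subalgebra along an injection\<close>

definition cstar_image ::
    "('a, 'm) cstar_algebra_scheme \<Rightarrow> 'a set \<Rightarrow> ('a \<Rightarrow> 'd) \<Rightarrow> 'd cstar_algebra" where
  "cstar_image A S j = (let g = inv_into S j in
     \<lparr>carrier = j ` S, monoid.mult = \<lambda>x y. j (g x \<otimes>\<^bsub>A\<^esub> g y), one = j \<one>\<^bsub>A\<^esub>, zero = j \<zero>\<^bsub>A\<^esub>,
      add = \<lambda>x y. j (g x \<oplus>\<^bsub>A\<^esub> g y), smult = \<lambda>c x. j (c \<odot>\<^bsub>A\<^esub> g x),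
      star = \<lambda>x. j (star A (g x)), cnorm = \<lambda>x. cnorm A (g x)\<rparr>)"

text \<open>In the application \<open>A\<close> is the operator algebra, \<open>S\<close> the
  closure of the operators coming from a covariant pair, and \<open>j\<close> their coding by
  sequences, so that \<open>D\<close> has the type of a test algebra.\<close>

locale cstar_subalgebra_image = unital_cstar_algebra A for A :: "('a, 'm) cstar_algebra_scheme" (structure) +
  fixes S :: "'a set" and j :: "'a \<Rightarrow> 'd"
  assumes subalgebra: "unital_cstar_subalgebra A S" and inj: "inj_on j S"
begin

abbreviation D where "D \<equiv> cstar_image A S j"

lemma subset: "x \<in> S \<Longrightarrow> x \<in> carrier A"
  using subalgebra by (auto simp: unital_cstar_subalgebra_def)

lemma closed:
  "\<one> \<in> S" "x \<in> S \<Longrightarrow> y \<in> S \<Longrightarrow> x \<oplus> y \<in> S" "x \<in> S \<Longrightarrow> y \<in> S \<Longrightarrow> x \<otimes> y \<in> S"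
  "x \<in> S \<Longrightarrow> star A x \<in> S" "x \<in> S \<Longrightarrow> c \<odot> x \<in> S"
  using subalgebra by (auto simp: unital_cstar_subalgebra_def)

lemma zero_mem: "\<zero> \<in> S"
  using closed(5)[OF closed(1), of 0] by (simp add: smult_zero_left)

lemma uminus_mem: "x \<in> S \<Longrightarrow> \<ominus> x \<in> S"
  using closed(5)[of x "- 1"] by (simp add: smult_minus_one subset)

lemma image_simps [simp]:
  "carrier D = j ` S" "\<one>\<^bsub>D\<^esub> = j \<one>" "\<zero>\<^bsub>D\<^esub> = j \<zero>"
  "x \<in> S \<Longrightarrow> y \<in> S \<Longrightarrow> j x \<otimes>\<^bsub>D\<^esub> j y = j (x \<otimes> y)"
  "x \<in> S \<Longrightarrow> y \<in> S \<Longrightarrow> j x \<oplus>\<^bsub>D\<^esub> j y = j (x \<oplus> y)"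
  "x \<in> S \<Longrightarrow> c \<odot>\<^bsub>D\<^esub> j x = j (c \<odot> x)"
  "x \<in> S \<Longrightarrow> star D (j x) = j (star A x)"
  "x \<in> S \<Longrightarrow> cnorm D (j x) = cnorm A x"
  by (simp_all add: cstar_image_def Let_def inv_into_f_f[OF inj])

lemma ring_image: "ring D"
proof (rule ringI)
  show "abelian_group D"
  proof (rule abelian_groupI)
    fix x assume "x \<in> carrier D"
    then obtain u where "x = j u" "u \<in> S" by auto
    then show "\<exists>y\<in>carrier D. y \<oplus>\<^bsub>D\<^esub> x = \<zero>\<^bsub>D\<^esub>"
      by (intro bexI[of _ "j (\<ominus> u)"]) (simp_all add: uminus_mem subset l_neg)
  qed (auto simp: closed zero_mem subset a_ac)
  show "monoid D"
    by (rule monoidI) (auto simp: closed subset m_assoc)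
qed (auto simp: closed subset l_distr r_distr)

lemma image_minus [simp]:
  assumes "x \<in> S" "y \<in> S"
  shows "j x \<ominus>\<^bsub>D\<^esub> j y = j (x \<ominus> y)"
proof -
  interpret D: ring D by (rule ring_image)
  have "\<ominus>\<^bsub>D\<^esub> j y = j (\<ominus> y)"
    using assms by (intro D.minus_equality) (simp_all add: uminus_mem subset l_neg)
  then show ?thesis
    using assms by (simp add: D.minus_eq uminus_mem minus_eq)
qed

lemma minus_mem: "x \<in> S \<Longrightarrow> y \<in> S \<Longrightarrow> x \<ominus> y \<in> S"
  by (simp add: minus_eq closed uminus_mem)

text \<open>The ambient algebra supplies the limit, and closedness of \<open>S\<close> keeps it
  inside.\<close>

lemma complete_image:
  assumes f: "\<forall>n::nat. f n \<in> carrier D"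
    and C: "\<forall>e>0. \<exists>N. \<forall>m\<ge>N. \<forall>n\<ge>N. cnorm D (f m \<ominus>\<^bsub>D\<^esub> f n) < e"
  shows "\<exists>x\<in>carrier D. (\<lambda>n. cnorm D (f n \<ominus>\<^bsub>D\<^esub> x)) \<longlonglongrightarrow> 0"
proof -
  obtain u where u: "\<And>n. u n \<in> S" "\<And>n. f n = j (u n)"
    using f by (auto simp: image_iff) metis
  then have "\<forall>e>0. \<exists>N. \<forall>m\<ge>N. \<forall>n\<ge>N. cnorm A (u m \<ominus> u n) < e"
    using C by (simp add: minus_mem)
  then obtain x where x: "x \<in> carrier A" "(\<lambda>n. cnorm A (u n \<ominus> x)) \<longlonglongrightarrow> 0"
    using cnorm_complete[of u] u subset by blast
  have "x \<in> S"
  proof -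
    have "\<exists>y\<in>S. cnorm A (x \<ominus> y) < e" if "e > 0" for e
    proof -
      obtain n where "cnorm A (u n \<ominus> x) < e"
        using order_tendstoD(2)[OF x(2) \<open>e > 0\<close>] by (auto simp: eventually_sequentially)
      then show ?thesis
        using u(1) x(1) by (intro bexI[of _ "u n"]) (simp_all add: cnorm_minus_commute subset)
    qed
    then show ?thesis
      using subalgebra x(1) by (auto simp: unital_cstar_subalgebra_def)
  qed
  then show ?thesis
    using x(2) u by (intro bexI[of _ "j x"]) (simp_all add: minus_mem)
qed

lemma unital_cstar_algebra_image: "unital_cstar_algebra D"
proof (intro unital_cstar_algebra.intro ring_image unital_cstar_algebra_axioms.intro complete_image)
  fix x assume "x \<in> carrier D"
  then obtain u where u: "x = j u" "u \<in> S" by auto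
  then show "(cnorm D x = 0) = (x = \<zero>\<^bsub>D\<^esub>)"
    using inj by (simp add: cnorm_eq_zero subset inj_on_eq_iff zero_mem)
qed (auto simp: closed subset smult_l_distr smult_r_distr smult_assoc smult_one smult_mult_left
    smult_mult_right star_star star_add star_smult star_mult cnorm_nonneg cnorm_triangle cnorm_smult
    cnorm_mult cstar_identity)

text \<open>Composing with this map turns a homomorphism into the transported copy back into one
  with values in \<open>A\<close>.\<close>

lemma inv_into_hom: "inv_into S j \<in> unital_star_hom D A"
  by (auto simp: unital_star_hom_def ring_hom_def inv_into_f_f[OF inj] closed subset)

end

section \<open>Representations\<close>

locale cstar_representation = unital_cstar_algebra B for B :: "'b cstar_algebra" (structure) +
  fixes \<pi> :: "'b \<Rightarrow> 'h::complex_hilbert_space \<Rightarrow> 'h"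
  assumes representation: "representation B \<pi>"
begin

lemma bounded_linear_rep: "x \<in> carrier B \<Longrightarrow> bounded_linear (\<pi> x)"
  and rep_one: "\<pi> \<one> \<xi> = \<xi>"
  and rep_add: "x \<in> carrier B \<Longrightarrow> y \<in> carrier B \<Longrightarrow> \<pi> (x \<oplus> y) \<xi> = \<pi> x \<xi> + \<pi> y \<xi>"
  and rep_smult: "x \<in> carrier B \<Longrightarrow> \<pi> (c \<odot> x) \<xi> = c *\<^sub>C \<pi> x \<xi>"
  and rep_mult: "x \<in> carrier B \<Longrightarrow> y \<in> carrier B \<Longrightarrow> \<pi> (x \<otimes> y) \<xi> = \<pi> x (\<pi> y \<xi>)"
  and rep_star: "x \<in> carrier B \<Longrightarrow> cinner (\<pi> x \<xi>) \<eta> = cinner \<xi> (\<pi> (star B x) \<eta>)"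
  using representation by (auto simp: representation_def bounded_clinear_def)

lemma nonzero_vector: "\<exists>\<xi>::'h. \<xi> \<noteq> 0"
  using representation by (auto simp: representation_def)

lemma rep_minus: "x \<in> carrier B \<Longrightarrow> y \<in> carrier B \<Longrightarrow> \<pi> (x \<ominus> y) \<xi> = \<pi> x \<xi> - \<pi> y \<xi>"
  using scaleC_of_real[of "- 1" "\<pi> y \<xi>"]
  by (simp add: minus_eq_smult rep_add rep_smult smult_closed)

definition op :: "'b \<Rightarrow> 'h \<Rightarrow>\<^sub>L 'h" where
  "op x = Blinfun (\<pi> x)"

lemma apply_op [simp]: "x \<in> carrier B \<Longrightarrow> blinfun_apply (op x) = \<pi> x"
  by (simp add: op_def bounded_linear_Blinfun_apply bounded_linear_rep)

lemma is_adjoint_op: "x \<in> carrier B \<Longrightarrow> is_adjoint (op x) (op (star B x))"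
  by (simp add: is_adjoint_def star_closed rep_star)

lemma rep_scaleC: "x \<in> carrier B \<Longrightarrow> \<pi> x (c *\<^sub>C \<xi>) = c *\<^sub>C \<pi> x \<xi>"
  using is_adjoint_clinear[OF is_adjoint_op, of x c \<xi>] by simp

lemma norm_op_le:
  assumes x: "x \<in> carrier B"
  shows "norm (op x) \<le> cnorm B x"
proof (rule ccontr)
  define r where "r = norm (op x)"
  assume "\<not> ?thesis"
  then have less: "cnorm B x < r" by (simp add: r_def)
  have r: "r > 0" using less cnorm_nonneg[OF x] by simp
  define h where "h = complex_of_real (1 / r\<^sup>2) \<odot> (star B x \<otimes> x)"
  have h: "h \<in> carrier B" using x by (simp add: h_def smult_closed star_closed)
  have "cnorm B h = (cnorm B x / r)\<^sup>2"
    using x r by (simp add: h_def cnorm_smult star_closed cstar_identity norm_divide norm_power power_divide)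
  also have "\<dots> < 1"
    using less r cnorm_nonneg[OF x] by (simp add: power_less_one_iff)
  finally obtain y where y: "y \<in> carrier B" "y \<otimes> (\<one> \<ominus> h) = \<one>"
    using left_inverse_near_one[OF h] by blast
  define K where "K = norm (op y)"
  \<comment> \<open>Applying \<open>y\<close> to (1 - h) \<xi> bounds 1 - h from below. In the
    expanded square the cross term is -2 |\<pi> x \<xi>|^2 / r^2, while the quadratic term is at
    most |\<pi> x \<xi>|^2 / r^2 because the adjoint operator also has norm
    \<open>r\<close>.\<close>
  have ineq: "(norm \<xi>)\<^sup>2 \<le> K\<^sup>2 * ((norm \<xi>)\<^sup>2 - (norm (\<pi> x \<xi>))\<^sup>2 / r\<^sup>2)" for \<xi>
  proof -
    let ?\<zeta> = "\<pi> (star B x) (\<pi> x \<xi>)"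
    have "\<xi> = op y (\<pi> (\<one> \<ominus> h) \<xi>)"
      using y h by (simp add: rep_one flip: rep_mult)
    then have "norm \<xi> \<le> K * norm (\<pi> (\<one> \<ominus> h) \<xi>)"
      unfolding K_def by (metis norm_blinfun)
    then have "(norm \<xi>)\<^sup>2 \<le> K\<^sup>2 * (norm (\<pi> (\<one> \<ominus> h) \<xi>))\<^sup>2"
      by (metis norm_ge_zero power_mono power_mult_distrib)
    also have "\<pi> (\<one> \<ominus> h) \<xi> = \<xi> - (1 / r\<^sup>2) *\<^sub>R ?\<zeta>"
      using h x by (simp only: rep_minus rep_one one_closed)
        (simp add: h_def rep_smult rep_mult star_closed scaleC_of_real flip: of_real_power of_real_divide)
    also have "(norm (\<xi> - (1 / r\<^sup>2) *\<^sub>R ?\<zeta>))\<^sup>2 \<le> (norm \<xi>)\<^sup>2 - (norm (\<pi> x \<xi>))\<^sup>2 / r\<^sup>2"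
    proof -
      have "inner \<xi> ?\<zeta> = (norm (\<pi> x \<xi>))\<^sup>2"
        using x by (simp add: power2_norm_eq_inner flip: Re_cinner rep_star)
      moreover have "(norm ?\<zeta>)\<^sup>2 \<le> r\<^sup>2 * (norm (\<pi> x \<xi>))\<^sup>2"
      proof -
        have "norm ?\<zeta> \<le> r * norm (\<pi> x \<xi>)"
          using norm_blinfun[of "op (star B x)" "\<pi> x \<xi>"] x
          by (simp add: star_closed r_def norm_is_adjoint[OF is_adjoint_op])
        then show ?thesis by (metis norm_ge_zero power_mono power_mult_distrib)
      qed
      then have "(1 / r\<^sup>2)\<^sup>2 * (norm ?\<zeta>)\<^sup>2 \<le> (1 / r\<^sup>2)\<^sup>2 * (r\<^sup>2 * (norm (\<pi> x \<xi>))\<^sup>2)"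
        by (rule mult_left_mono) simp
      then have "(1 / r\<^sup>2)\<^sup>2 * (norm ?\<zeta>)\<^sup>2 \<le> (norm (\<pi> x \<xi>))\<^sup>2 / r\<^sup>2"
        using r by (simp add: power2_eq_square)
      moreover have "(norm (\<xi> - (1 / r\<^sup>2) *\<^sub>R ?\<zeta>))\<^sup>2 =
          (norm \<xi>)\<^sup>2 - 2 * (1 / r\<^sup>2) * inner \<xi> ?\<zeta> + (1 / r\<^sup>2)\<^sup>2 * (norm ?\<zeta>)\<^sup>2"
        by (simp only: power2_norm_eq_inner)
          (simp add: inner_diff inner_commute power2_eq_square algebra_simps)
      ultimately show ?thesis by simp
    qed
    finally show ?thesis by (simp add: mult_left_mono)
  qed
  obtain \<xi>\<^sub>0 :: 'h where "\<xi>\<^sub>0 \<noteq> 0" using nonzero_vector by blast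
  then have "K \<noteq> 0" using ineq[of \<xi>\<^sub>0] by auto
  then have K: "K\<^sup>2 > 0" by simp
  \<comment> \<open>Solving \<open>ineq\<close> for |\<pi> x \<xi>| leaves a factor strictly below
    \<open>r\<close>, against the choice of \<open>r\<close> as the operator norm.\<close>
  have bound: "(norm (\<pi> x \<xi>))\<^sup>2 \<le> r\<^sup>2 * (1 - 1 / K\<^sup>2) * (norm \<xi>)\<^sup>2" for \<xi>
    using ineq[of \<xi>] K r by (simp add: field_simps)
  have nonneg: "0 \<le> 1 - 1 / K\<^sup>2"
  proof (rule ccontr)
    assume "\<not> ?thesis"
    then have "r\<^sup>2 * (1 - 1 / K\<^sup>2) * (norm \<xi>\<^sub>0)\<^sup>2 < 0"
      using r \<open>\<xi>\<^sub>0 \<noteq> 0\<close> by (simp add: mult_pos_neg mult_neg_pos)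
    then show False using bound[of \<xi>\<^sub>0] zero_le_power2[of "norm (\<pi> x \<xi>\<^sub>0)"] by linarith
  qed
  have "norm (op x) \<le> r * sqrt (1 - 1 / K\<^sup>2)"
  proof (rule norm_blinfun_bound)
    fix \<xi>
    have "(norm (op x \<xi>))\<^sup>2 \<le> (r * sqrt (1 - 1 / K\<^sup>2) * norm \<xi>)\<^sup>2"
      using bound[of \<xi>] x nonneg by (simp add: power_mult_distrib)
    then show "norm (op x \<xi>) \<le> r * sqrt (1 - 1 / K\<^sup>2) * norm \<xi>"
      using r nonneg by (intro power2_le_imp_le[of "norm (op x \<xi>)"]) simp_all
  qed (use r nonneg in simp)
  also have "\<dots> < r * 1"
    using r K by (intro mult_strict_left_mono real_sqrt_lt_1_iff[THEN iffD2]) simp_all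
  finally show False by (simp add: r_def)
qed

section \<open>Passing from generators to the whole algebra\<close>

lemma norm_rep_diff_le:
  assumes "x \<in> carrier B" "y \<in> carrier B"
  shows "norm (\<pi> x \<xi> - \<pi> y \<xi>) \<le> cnorm B (x \<ominus> y) * norm \<xi>"
proof -
  have "norm (\<pi> x \<xi> - \<pi> y \<xi>) \<le> norm (op (x \<ominus> y)) * norm \<xi>"
    using norm_blinfun[of "op (x \<ominus> y)" \<xi>] assms by (simp add: rep_minus)
  also have "\<dots> \<le> cnorm B (x \<ominus> y) * norm \<xi>"
    using assms by (intro mult_right_mono norm_op_le) auto
  finally show ?thesis .
qed

text \<open>Puts the limit case of \<open>generated_induct\<close> into the form of a sequence:
  contractivity gives pointwise convergence of the operators. The norm convergence is kept for use
  with a second representation.\<close>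

lemma rep_near:
  assumes x: "x \<in> carrier B"
    and near: "\<And>e. e > 0 \<Longrightarrow> \<exists>y\<in>carrier B. P y \<and> cnorm B (x \<ominus> y) < e"
  obtains u where "\<And>n. u n \<in> carrier B" "\<And>n. P (u n)" "\<And>\<xi>. (\<lambda>n. \<pi> (u n) \<xi>) \<longlonglongrightarrow> \<pi> x \<xi>"
    "(\<lambda>n. cnorm B (x \<ominus> u n)) \<longlonglongrightarrow> 0"
proof -
  have "\<forall>n. \<exists>y\<in>carrier B. P y \<and> cnorm B (x \<ominus> y) < 1 / Suc n"
    using near by simp
  then obtain u where u: "\<And>n. u n \<in> carrier B" "\<And>n. P (u n)" "\<And>n. cnorm B (x \<ominus> u n) < 1 / Suc n"
    by metis
  have lim: "(\<lambda>n. cnorm B (x \<ominus> u n)) \<longlonglongrightarrow> 0"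
  proof (rule Lim_null_comparison)
    show "(\<lambda>n. 1 / real (Suc n)) \<longlonglongrightarrow> 0" by (rule lim_1_over_n[THEN LIMSEQ_Suc])
    show "\<forall>\<^sub>F n in sequentially. norm (cnorm B (x \<ominus> u n)) \<le> 1 / real (Suc n)"
      using u x by (intro always_eventually) (simp add: cnorm_nonneg less_imp_le)
  qed
  have "(\<lambda>n. \<pi> (u n) \<xi>) \<longlonglongrightarrow> \<pi> x \<xi>" for \<xi>
  proof (rule LIM_zero_cancel, rule Lim_null_comparison)
    show "\<forall>\<^sub>F n in sequentially. norm (\<pi> (u n) \<xi> - \<pi> x \<xi>) \<le> cnorm B (x \<ominus> u n) * norm \<xi>"
      using u(1) x by (intro always_eventually) (metis norm_minus_commute norm_rep_diff_le)
    show "(\<lambda>n. cnorm B (x \<ominus> u n) * norm \<xi>) \<longlonglongrightarrow> 0"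
      using lim by (rule tendsto_mult_left_zero)
  qed
  with u lim show thesis by (intro that)
qed

text \<open>Commuting with \<open>V\<close> is preserved by pointwise limits since \<open>V\<close>
  is continuous. Scalar multiples need \<open>V\<close> to be complex-linear, which the adjoint
  \<open>V'\<close> ensures.\<close>

lemma commutes_if_commutes_generators:
  assumes gen: "cstar_generated_by B G" and x: "x \<in> carrier B" and V: "is_adjoint V V'"
    and G: "\<And>x \<xi>. x \<in> G \<Longrightarrow> \<pi> x (V \<xi>) = V (\<pi> x \<xi>)"
    and star_G: "\<And>x \<xi>. x \<in> G \<Longrightarrow> \<pi> (star B x) (V \<xi>) = V (\<pi> (star B x) \<xi>)"
  shows "\<pi> x (V \<xi>) = V (\<pi> x \<xi>)"
proof -
  have "\<forall>\<xi>. \<pi> x (V \<xi>) = V (\<pi> x \<xi>)"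
    using gen x
  proof (induction x rule: generated_induct)
    case (limit x)
    obtain u where u: "\<And>n. \<forall>\<xi>. \<pi> (u n) (V \<xi>) = V (\<pi> (u n) \<xi>)"
        "\<And>\<xi>. (\<lambda>n. \<pi> (u n) \<xi>) \<longlonglongrightarrow> \<pi> x \<xi>"
      by (rule rep_near[OF limit]) (assumption, rule that)
    show ?case
    proof
      fix \<xi>
      have "(\<lambda>n. \<pi> (u n) (V \<xi>)) \<longlonglongrightarrow> V (\<pi> x \<xi>)"
        unfolding u(1)[rule_format] by (intro tendsto_intros u(2))
      then show "\<pi> x (V \<xi>) = V (\<pi> x \<xi>)"
        by (rule LIMSEQ_unique[OF u(2)])
    qed
  qed (simp_all add: G star_G rep_one rep_add rep_mult rep_smult blinfun.add_right
      is_adjoint_clinear[OF V])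
  then show ?thesis by blast
qed

text \<open>Lets an invariant subspace for one crossed product be tested against the other, with
  which it shares its generators up to scalars.\<close>

lemma invariant_if_generators_invariant:
  assumes gen: "cstar_generated_by B G" and x: "x \<in> carrier B"
    and M: "closed M" "subspace M" "\<And>c \<xi>. \<xi> \<in> M \<Longrightarrow> c *\<^sub>C \<xi> \<in> M"
    and G: "\<And>x \<xi>. x \<in> G \<Longrightarrow> \<xi> \<in> M \<Longrightarrow> \<pi> x \<xi> \<in> M"
    and star_G: "\<And>x \<xi>. x \<in> G \<Longrightarrow> \<xi> \<in> M \<Longrightarrow> \<pi> (star B x) \<xi> \<in> M"
    and \<xi>: "\<xi> \<in> M"
  shows "\<pi> x \<xi> \<in> M"
proof -
  have "\<forall>\<xi>\<in>M. \<pi> x \<xi> \<in> M"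
    using gen x
  proof (induction x rule: generated_induct)
    case (limit x)
    obtain u where u: "\<And>n. \<forall>\<xi>\<in>M. \<pi> (u n) \<xi> \<in> M"
        "\<And>\<xi>. (\<lambda>n. \<pi> (u n) \<xi>) \<longlonglongrightarrow> \<pi> x \<xi>"
      by (rule rep_near[OF limit]) (assumption, rule that)
    show ?case
    proof
      fix \<xi> assume "\<xi> \<in> M"
      then show "\<pi> x \<xi> \<in> M"
        using u(1) by (intro closed_sequentially[OF M(1) _ u(2)]) blast
    qed
  qed (simp_all add: G star_G M rep_one rep_add rep_mult rep_smult subspace_add)
  with \<xi> show ?thesis by blast
qed

end

text \<open>The source of uniqueness in the theorem. Agreement passes to stars because adjoints are
  unique, and to limits because both representations are contractive, so one approximating sequence
  serves both.\<close>

lemma representation_eq_if_eq_generators: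
  assumes B: "unital_cstar_algebra B" and rep: "representation B \<pi>" "representation B \<pi>'"
    and gen: "cstar_generated_by B G" and G: "\<And>x. x \<in> G \<Longrightarrow> \<pi> x = \<pi>' x" and x: "x \<in> carrier B"
  shows "\<pi> x = \<pi>' x"
proof -
  interpret R: cstar_representation B \<pi>
    by (intro cstar_representation.intro cstar_representation_axioms.intro B rep)
  interpret R': cstar_representation B \<pi>'
    by (intro cstar_representation.intro cstar_representation_axioms.intro B rep)
  have GB: "G \<subseteq> carrier B" using gen by (simp add: cstar_generated_by_def)
  show ?thesis
    using gen x
  proof (induction x rule: R.generated_induct)
    case (star x)
    then have "is_adjoint (R.op x) (R.op (star B x))" "is_adjoint (R.op x) (R'.op (star B x))"
      using GB R.is_adjoint_op[of x] R'.is_adjoint_op[of x] by (auto simp: R.op_def R'.op_def G)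
    then have "R.op (star B x) = R'.op (star B x)"
      by (rule is_adjoint_unique)
    then show ?case
      using star GB by (metis R.apply_op R'.apply_op R.star_closed subsetD)
  next
    case (limit x)
    obtain u where u: "\<And>n. u n \<in> carrier B" "\<And>n. \<pi> (u n) = \<pi>' (u n)"
        "\<And>\<xi>. (\<lambda>n. \<pi> (u n) \<xi>) \<longlonglongrightarrow> \<pi> x \<xi>" and lim: "(\<lambda>n. cnorm B (x \<ominus>\<^bsub>B\<^esub> u n)) \<longlonglongrightarrow> 0"
      by (rule R.rep_near[OF limit]) (assumption, rule that)
    show ?case
    proof
      fix \<xi>
      have "(\<lambda>n. \<pi>' (u n) \<xi>) \<longlonglongrightarrow> \<pi>' x \<xi>"
      proof (rule LIM_zero_cancel, rule Lim_null_comparison)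
        show "\<forall>\<^sub>F n in sequentially. norm (\<pi>' (u n) \<xi> - \<pi>' x \<xi>) \<le> cnorm B (x \<ominus>\<^bsub>B\<^esub> u n) * norm \<xi>"
          using u(1) limit(1) by (intro always_eventually) (metis norm_minus_commute R'.norm_rep_diff_le)
        show "(\<lambda>n. cnorm B (x \<ominus>\<^bsub>B\<^esub> u n) * norm \<xi>) \<longlonglongrightarrow> 0"
          using lim by (rule tendsto_mult_left_zero)
      qed
      then show "\<pi> x \<xi> = \<pi>' x \<xi>"
        using LIMSEQ_unique[OF u(3)] by (simp add: u(2))
    qed
  qed (auto simp: G R.rep_one R'.rep_one R.rep_add R'.rep_add R.rep_mult R'.rep_mult R.rep_smult
      R'.rep_smult)
qed

section \<open>Square roots and Schur's lemma\<close>

lemma norm_compose_le: "norm S \<le> s \<Longrightarrow> norm T \<le> t \<Longrightarrow> norm (S o\<^sub>L T) \<le> s * t"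
  by (rule order_trans[OF norm_blinfun_compose mult_mono']) simp_all

text \<open>
  The square root of \<open>id - B\<close> is \<open>id - Y\<close> for a fixed point \<open>Y = (B + Y\<^sup>2) / 2\<close>.  The iteration
  starting from zero is dominated in norm, together with its increments, by the scalar one for
  \<open>B = 1\<close>, which increases to 1.
\<close>

lemma square_root_id_minus:
  fixes B :: "'h::banach \<Rightarrow>\<^sub>L 'h"
  assumes B: "norm B \<le> 1"
  obtains Y where "norm Y \<le> 1" "(id_blinfun - Y) o\<^sub>L (id_blinfun - Y) = id_blinfun - B"
    "\<And>Z. Z o\<^sub>L B = B o\<^sub>L Z \<Longrightarrow> Z o\<^sub>L Y = Y o\<^sub>L Z"
proof -
  define Y where "Y = rec_nat 0 (\<lambda>_ Y. (1/2) *\<^sub>R (B + (Y o\<^sub>L Y)))"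
  have Y_0: "Y 0 = 0" and Y_Suc: "Y (Suc n) = (1/2) *\<^sub>R (B + (Y n o\<^sub>L Y n))" for n
    by (simp_all add: Y_def)
  define y :: "nat \<Rightarrow> real" where "y = rec_nat 0 (\<lambda>_ y. (1 + y\<^sup>2) / 2)"
  have y_0: "y 0 = 0" and y_Suc: "y (Suc n) = (1 + (y n)\<^sup>2) / 2" for n
    by (simp_all add: y_def)
  have y_bounds: "0 \<le> y n \<and> y n \<le> 1" for n
  proof (induction n)
    case (Suc n)
    then have "(y n)\<^sup>2 \<le> 1" by (simp add: power_le_one)
    then show ?case by (simp add: y_Suc)
  qed (simp add: y_0)
  have "y n \<le> y (Suc n)" for n
    using zero_le_power2[of "1 - y n"] by (simp add: y_Suc power2_diff)
  then have "incseq y" by (rule incseq_SucI)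
  then have "Cauchy y"
    using y_bounds by (metis LIMSEQ_imp_Cauchy incseq_convergent)
  have commute: "Z o\<^sub>L Y n = Y n o\<^sub>L Z" if "Z o\<^sub>L B = B o\<^sub>L Z" for Z n
  proof (induction n)
    case (Suc n)
    have "Z (Y n \<xi>) = Y n (Z \<xi>)" "Z (B \<xi>) = B (Z \<xi>)" for \<xi>
      using Suc that by (metis blinfun_apply_blinfun_compose)+
    then show ?case
      by (intro blinfun_eqI) (simp add: Y_Suc blinfun.bilinear_simps)
  qed (simp add: Y_0)
  have norm_Y: "norm (Y n) \<le> y n" for n
  proof (induction n)
    case (Suc n)
    have "norm (Y n o\<^sub>L Y n) \<le> y n * y n"
      by (intro norm_compose_le Suc)
    then have "norm (B + (Y n o\<^sub>L Y n)) \<le> 1 + y n * y n"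
      using B by (intro norm_triangle_mono)
    then show ?case by (simp add: Y_Suc y_Suc power2_eq_square)
  qed (simp add: Y_0 y_0)
  have step: "norm (Y (Suc n) - Y n) \<le> y (Suc n) - y n" for n
  proof (induction n)
    case 0
    then show ?case using B by (simp add: Y_Suc y_Suc Y_0 y_0)
  next
    case (Suc n)
    \<comment> \<open>All iterates commute with each other since they commute with \<open>B\<close>,
      so the difference of two squares factors as it does for scalars.\<close>
    have "Y n (Y (Suc n) \<xi>) = Y (Suc n) (Y n \<xi>)" for \<xi>
      using commute[of "Y n" "Suc n"] commute[of B n] by (metis blinfun_apply_blinfun_compose)
    then have "Y (Suc (Suc n)) - Y (Suc n) =
        (1/2) *\<^sub>R ((Y (Suc n) + Y n) o\<^sub>L (Y (Suc n) - Y n))"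
      unfolding Y_Suc[of "Suc n"] by (subst (3) Y_Suc, intro blinfun_eqI)
        (simp add: blinfun.bilinear_simps algebra_simps)
    also have "norm \<dots> \<le> (1/2) * ((y (Suc n) + y n) * (y (Suc n) - y n))"
    proof -
      have "norm ((Y (Suc n) + Y n) o\<^sub>L (Y (Suc n) - Y n)) \<le> (y (Suc n) + y n) * (y (Suc n) - y n)"
        by (intro norm_compose_le norm_triangle_mono norm_Y Suc)
      then show ?thesis by simp
    qed
    also have "\<dots> = y (Suc (Suc n)) - y (Suc n)"
    proof -
      have "(y n)\<^sup>2 = 2 * y (Suc n) - 1"
        by (simp add: y_Suc[of n] field_simps)
      then show ?thesis
        by (simp add: y_Suc[of "Suc n"] power2_eq_square algebra_simps)
    qed
    finally show ?case .
  qed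
  have diff: "norm (Y (n + k) - Y n) \<le> y (n + k) - y n" for n k
  proof (induction k)
    case (Suc k)
    have "Y (n + Suc k) - Y n = (Y (Suc (n + k)) - Y (n + k)) + (Y (n + k) - Y n)"
      by simp
    also have "norm \<dots> \<le> (y (Suc (n + k)) - y (n + k)) + (y (n + k) - y n)"
      by (intro norm_triangle_mono step Suc)
    finally show ?case by simp
  qed simp
  have "dist (Y m) (Y n) \<le> dist (y m) (y n)" for m n
  proof (cases "n \<le> m")
    case True
    then show ?thesis using diff[of n "m - n"] by (simp add: dist_norm)
  next
    case False
    then have "norm (Y n - Y m) \<le> y n - y m" using diff[of m "n - m"] by simp
    then show ?thesis by (simp add: dist_norm norm_minus_commute abs_minus_commute)
  qed
  then have "Cauchy Y"
    using \<open>Cauchy y\<close> unfolding Cauchy_def by (meson le_less_trans)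
  then obtain L where L: "Y \<longlonglongrightarrow> L"
    by (metis Cauchy_convergent convergent_def)
  show thesis
  proof (rule that)
    have "norm (Y n) \<le> 1" for n
      using norm_Y[of n] y_bounds[of n] by simp
    then show "norm L \<le> 1"
      by (intro LIMSEQ_le_const2[OF tendsto_norm[OF L]]) blast
    have "(\<lambda>n. Y (Suc n)) \<longlonglongrightarrow> (1/2) *\<^sub>R (B + (L o\<^sub>L L))"
      unfolding Y_Suc
      by (intro tendsto_intros L bounded_bilinear.tendsto[OF bounded_bilinear_blinfun_compose])
    then have "L = (1/2) *\<^sub>R (B + (L o\<^sub>L L))"
      using LIMSEQ_unique LIMSEQ_Suc[OF L] by blast
    then have "2 *\<^sub>R L = B + (L o\<^sub>L L)"
      by (metis scaleR_half_double scaleR_2 scaleR_scaleR scaleR_right_distrib)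
    then have "2 *\<^sub>R L \<xi> = B \<xi> + L (L \<xi>)" for \<xi>
      by (metis blinfun.add_left blinfun.scaleR_left blinfun_apply_blinfun_compose)
    then have "L (L \<xi>) = 2 *\<^sub>R L \<xi> - B \<xi>" for \<xi>
      by simp
    then show "(id_blinfun - L) o\<^sub>L (id_blinfun - L) = id_blinfun - B"
      by (intro blinfun_eqI) (simp add: blinfun.bilinear_simps scaleR_2)
    fix Z assume Z: "Z o\<^sub>L B = B o\<^sub>L Z"
    have "(\<lambda>n. Z o\<^sub>L Y n) \<longlonglongrightarrow> (Z o\<^sub>L L)" "(\<lambda>n. Y n o\<^sub>L Z) \<longlonglongrightarrow> (L o\<^sub>L Z)"
      by (intro tendsto_const L bounded_bilinear.tendsto[OF bounded_bilinear_blinfun_compose])+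
    then show "Z o\<^sub>L L = L o\<^sub>L Z"
      using LIMSEQ_unique by (simp add: commute[OF Z])
  qed
qed

text \<open>Equality in Cauchy-Schwarz: expanding |Y \<xi> - \<xi>|^2 leaves |Y \<xi>|^2 -
  |\<xi>|^2, which is at most zero.\<close>

lemma fixed_if_inner_eq:
  fixes Y :: "'h::real_inner \<Rightarrow>\<^sub>L 'h"
  assumes "norm Y \<le> 1" "inner (Y \<xi>) \<xi> = inner \<xi> \<xi>"
  shows "Y \<xi> = \<xi>"
proof -
  have "norm (Y \<xi>) \<le> norm \<xi>"
    using norm_blinfun[of Y \<xi>] assms(1) mult_right_mono[of "norm Y" 1 "norm \<xi>"] by simp
  then have "(norm (Y \<xi>))\<^sup>2 \<le> (norm \<xi>)\<^sup>2" by simp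
  then have "inner (Y \<xi> - \<xi>) (Y \<xi> - \<xi>) \<le> 0"
    using assms(2) by (simp add: inner_diff inner_commute power2_norm_eq_inner)
  then have "inner (Y \<xi> - \<xi>) (Y \<xi> - \<xi>) = 0"
    by (intro antisym inner_ge_zero)
  then show ?thesis by simp
qed

text \<open>Admits 1 - H^2 as the \<open>B\<close> of \<open>square_root_id_minus\<close>, which
  then yields a square root of H^2. In |\<xi> - H^2 \<xi>|^2 the cross term is -2 |H \<xi>|^2 by
  symmetry and outweighs |H^2 \<xi>|^2.\<close>

lemma norm_id_minus_square_le:
  fixes H :: "'h::real_inner \<Rightarrow>\<^sub>L 'h"
  assumes H: "norm H \<le> 1" and sym: "\<And>x y. inner (H x) y = inner x (H y)"
  shows "norm (id_blinfun - (H o\<^sub>L H)) \<le> 1"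
proof (rule norm_blinfun_bound)
  fix \<xi>
  have "norm (H (H \<xi>)) \<le> norm (H \<xi>)"
    using norm_blinfun[of H "H \<xi>"] H mult_right_mono[of "norm H" 1 "norm (H \<xi>)"] by simp
  then have "inner (H (H \<xi>)) (H (H \<xi>)) \<le> inner (H \<xi>) (H \<xi>)"
    by (simp flip: power2_norm_eq_inner)
  moreover have "inner \<xi> (H (H \<xi>)) = inner (H \<xi>) (H \<xi>)"
    by (simp add: sym)
  moreover have "inner (\<xi> - H (H \<xi>)) (\<xi> - H (H \<xi>)) =
      inner \<xi> \<xi> - 2 * inner \<xi> (H (H \<xi>)) + inner (H (H \<xi>)) (H (H \<xi>))"
    by (simp add: inner_diff inner_commute)
  ultimately have "inner (\<xi> - H (H \<xi>)) (\<xi> - H (H \<xi>)) \<le> inner \<xi> \<xi>"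
    using inner_ge_zero[of "H \<xi>"] by linarith
  then have "norm (\<xi> - H (H \<xi>)) \<le> norm \<xi>"
    by (simp add: norm_le)
  then show "norm ((id_blinfun - (H o\<^sub>L H)) \<xi>) \<le> 1 * norm \<xi>"
    by (simp add: blinfun.bilinear_simps)
qed simp

section \<open>Schur's lemma\<close>

context cstar_representation
begin

text \<open>The kernel of an operator commuting with the representation is a closed invariant
  subspace, so a single nonzero vector in it makes it the whole space.\<close>

lemma irreducible_kernel:
  fixes S :: "'h \<Rightarrow>\<^sub>L 'h"
  assumes irr: "irreducible_representation B \<pi>"
    and clinear: "\<And>c \<xi>. S (c *\<^sub>C \<xi>) = c *\<^sub>C S \<xi>"
    and comm: "\<And>x \<xi>. x \<in> carrier B \<Longrightarrow> \<pi> x (S \<xi>) = S (\<pi> x \<xi>)"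
    and \<xi>: "S \<xi> = 0" "\<xi> \<noteq> 0"
  shows "S = 0"
proof -
  define M where "M = {\<xi>. S \<xi> = 0}"
  have "closed M"
    unfolding M_def by (intro closed_Collect_eq continuous_intros)
  moreover have "subspace M"
    by (auto simp: M_def subspace_def blinfun.bilinear_simps)
  moreover have "c *\<^sub>C \<xi> \<in> M" if "\<xi> \<in> M" for c \<xi>
    using that by (simp add: M_def clinear linear_0[OF linear_scaleC])
  moreover have "\<pi> x \<xi> \<in> M" if "x \<in> carrier B" "\<xi> \<in> M" for x \<xi>
    using that by (simp add: M_def linear_0[OF bounded_linear.linear[OF bounded_linear_rep]] flip: comm)
  ultimately have "M = {0} \<or> M = UNIV"
    using irr unfolding irreducible_representation_def by blast
  moreover have "\<xi> \<in> M" using \<xi> by (simp add: M_def)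
  ultimately have "\<eta> \<in> M" for \<eta> using \<xi> by auto
  then show ?thesis
    by (intro blinfun_eqI) (simp add: M_def)
qed

text \<open>
  With \<open>t\<close> the mean value of \<open>T\<close> at a vector \<open>\<xi>\<close> and \<open>H\<close> a multiple of \<open>T - t\<close>, let \<open>R\<close> be the
  square root of \<open>H\<^sup>2\<close>.  Since \<open>(R - H) (R + H) = 0\<close>, irreducibility gives \<open>R = H\<close> or \<open>R = - H\<close>, and
  as \<open>R\<close> has mean value zero at \<open>\<xi>\<close>, it annihilates \<open>\<xi>\<close>.
\<close>

lemma schur_selfadjoint:
  assumes irr: "irreducible_representation B \<pi>"
    and sym: "is_adjoint T T"
    and comm: "\<And>x \<xi>. x \<in> carrier B \<Longrightarrow> \<pi> x (T \<xi>) = T (\<pi> x \<xi>)"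
  obtains t :: real where "\<And>\<xi>. T \<xi> = t *\<^sub>R \<xi>"
proof -
  obtain \<xi>\<^sub>0 :: 'h where \<xi>\<^sub>0: "\<xi>\<^sub>0 \<noteq> 0" using nonzero_vector by blast
  define t where "t = inner (T \<xi>\<^sub>0) \<xi>\<^sub>0 / inner \<xi>\<^sub>0 \<xi>\<^sub>0"
  define T' where "T' = T - t *\<^sub>R id_blinfun"
  have T': "T' \<xi> = T \<xi> - t *\<^sub>R \<xi>" for \<xi>
    by (simp add: T'_def blinfun.bilinear_simps)
  have rep_scaleR: "\<pi> x (r *\<^sub>R \<xi>) = r *\<^sub>R \<pi> x \<xi>" and rep_diff: "\<pi> x (\<xi> - \<eta>) = \<pi> x \<xi> - \<pi> x \<eta>"
    if "x \<in> carrier B" for x r \<xi> \<eta>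
    using bounded_linear_rep[OF that] by (simp_all add: bounded_linear.linear linear_scale linear_diff)
  have scaleC_scaleR: "c *\<^sub>C r *\<^sub>R \<xi> = r *\<^sub>R c *\<^sub>C \<xi>"
    and scaleC_diff: "c *\<^sub>C (\<xi> - \<eta>) = c *\<^sub>C \<xi> - c *\<^sub>C \<eta>" for c r and \<xi> \<eta> :: 'h
    by (simp_all add: linear_scale[OF linear_scaleC] linear_diff[OF linear_scaleC])
  have clinear': "T' (c *\<^sub>C \<xi>) = c *\<^sub>C T' \<xi>" for c \<xi>
    by (simp add: T' is_adjoint_clinear[OF sym] scaleC_scaleR scaleC_diff)
  have comm': "\<pi> x (T' \<xi>) = T' (\<pi> x \<xi>)" if "x \<in> carrier B" for x \<xi>
    using that by (simp add: T' comm rep_scaleR rep_diff)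
  have sym': "inner (T' \<xi>) \<eta> = inner \<xi> (T' \<eta>)" for \<xi> \<eta>
  proof -
    have "inner (T \<xi>) \<eta> = inner \<xi> (T \<eta>)"
      using sym by (simp add: is_adjoint_def flip: Re_cinner)
    then show ?thesis by (simp add: T' inner_diff)
  qed
  have mean: "inner (T' \<xi>\<^sub>0) \<xi>\<^sub>0 = 0"
    using \<xi>\<^sub>0 by (simp add: T' t_def inner_diff)
  have "T' \<xi>\<^sub>0 = 0"
  proof (cases "T' = 0")
    case False
    \<comment> \<open>The square root is available for contractions, hence the scaling.\<close>
    define H where "H = (1 / norm T') *\<^sub>R T'"
    have H: "norm H \<le> 1" "inner (H \<xi>) \<eta> = inner \<xi> (H \<eta>)" "H (c *\<^sub>C \<xi>) = c *\<^sub>C H \<xi>"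
      "x \<in> carrier B \<Longrightarrow> \<pi> x (H \<xi>) = H (\<pi> x \<xi>)" for \<xi> \<eta> c x
      by (simp_all add: H_def blinfun.bilinear_simps sym' clinear' scaleC_scaleR comm' rep_scaleR)
    obtain Y where Y: "norm Y \<le> 1"
        "(id_blinfun - Y) o\<^sub>L (id_blinfun - Y) = id_blinfun - (id_blinfun - (H o\<^sub>L H))"
        "\<And>Z. Z o\<^sub>L (id_blinfun - (H o\<^sub>L H)) = (id_blinfun - (H o\<^sub>L H)) o\<^sub>L Z \<Longrightarrow> Z o\<^sub>L Y = Y o\<^sub>L Z"
      by (rule square_root_id_minus[OF norm_id_minus_square_le[OF H(1,2)]])
        (rule that, assumption, assumption, blast)
    define R where "R = id_blinfun - Y"
    have R: "R (R \<xi>) = H (H \<xi>)" for \<xi>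
      using arg_cong[OF Y(2), of "\<lambda>F. blinfun_apply F \<xi>"] by (simp add: R_def blinfun.bilinear_simps)
    \<comment> \<open>\<open>R\<close> inherits commutation from \<open>H\<close>; this is used for
      complex scalars, for the representation and for \<open>H\<close> itself.\<close>
    have R_commute: "R (Z \<xi>) = Z (R \<xi>)" if "\<And>\<xi>. H (Z \<xi>) = Z (H \<xi>)"
      for Z :: "'h \<Rightarrow>\<^sub>L 'h" and \<xi>
    proof -
      have "Z o\<^sub>L Y = Y o\<^sub>L Z"
        using that by (intro Y(3) blinfun_eqI) (simp add: blinfun.bilinear_simps)
      then have "Z (Y \<xi>) = Y (Z \<xi>)" by (metis blinfun_apply_blinfun_compose)
      then show ?thesis by (simp add: R_def blinfun.bilinear_simps)
    qed
    have R_clinear: "R (c *\<^sub>C \<xi>) = c *\<^sub>C R \<xi>" for c \<xi>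
      using R_commute[of "cscale c"] H(3) by simp
    have R_comm: "\<pi> x (R \<xi>) = R (\<pi> x \<xi>)" if "x \<in> carrier B" for x \<xi>
      using R_commute[of "op x"] H(4) that by simp
    have "R = H \<or> R = - H"
    proof (rule disjCI)
      assume "R \<noteq> - H"
      then obtain \<eta> where "(R + H) \<eta> \<noteq> 0"
        by (metis blinfun_eqI blinfun.zero_left eq_neg_iff_add_eq_0)
      moreover have "(R - H) ((R + H) \<eta>) = 0"
        by (simp add: blinfun.bilinear_simps R R_commute)
      moreover have "(R - H) (c *\<^sub>C \<xi>) = c *\<^sub>C (R - H) \<xi>" for c \<xi>
        by (simp add: blinfun.bilinear_simps R_clinear H(3) scaleC_diff)
      moreover have "\<pi> x ((R - H) \<xi>) = (R - H) (\<pi> x \<xi>)" if "x \<in> carrier B" for x \<xi>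
        using that by (simp add: blinfun.bilinear_simps R_comm H(4) rep_diff)
      ultimately have "R - H = 0"
        using irreducible_kernel[OF irr] by blast
      then show "R = H" by simp
    qed
    moreover have "inner (H \<xi>\<^sub>0) \<xi>\<^sub>0 = 0"
      using mean by (simp add: H_def blinfun.bilinear_simps)
    \<comment> \<open>As R = 1 - Y, mean value zero says <Y \<xi>, \<xi>> = |\<xi>|^2 at the chosen
      vector. The contraction \<open>Y\<close> then fixes it, so \<open>R\<close>, and with it
      \<open>H\<close>, vanishes there.\<close>
    ultimately have "inner (R \<xi>\<^sub>0) \<xi>\<^sub>0 = 0" and H_R: "norm (H \<xi>\<^sub>0) = norm (R \<xi>\<^sub>0)"
      by (auto simp: blinfun.bilinear_simps)
    then have "Y \<xi>\<^sub>0 = \<xi>\<^sub>0"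
      using Y(1) by (intro fixed_if_inner_eq) (simp_all add: R_def blinfun.bilinear_simps inner_diff)
    then have "H \<xi>\<^sub>0 = 0"
      using H_R by (simp add: R_def blinfun.bilinear_simps)
    then show ?thesis using False by (simp add: H_def blinfun.bilinear_simps)
  qed simp
  then have "T' = 0"
    using irreducible_kernel[OF irr clinear' comm'] \<xi>\<^sub>0 by blast
  then have "T \<xi> = t *\<^sub>R \<xi>" for \<xi>
    using T'[of \<xi>] by simp
  then show thesis by (rule that)
qed

text \<open>Cartesian decomposition: 2 U is U + U' minus \<i> times \<i> (U - U'). Both of these
  operators are self-adjoint, hence real scalars \<open>a\<close> and \<open>b\<close>, and isometry
  of \<open>U\<close> puts (a - \<i> b) / 2 on the unit circle.\<close>

lemma schur_unitary:
  assumes irr: "irreducible_representation B \<pi>"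
    and U: "is_adjoint U U'" "\<And>\<xi>. U (U' \<xi>) = \<xi>" "\<And>\<xi>. U' (U \<xi>) = \<xi>"
    and comm: "\<And>x \<xi>. x \<in> carrier B \<Longrightarrow> \<pi> x (U \<xi>) = U (\<pi> x \<xi>)"
  obtains c where "cmod c = 1" "\<And>\<xi>. U \<xi> = c *\<^sub>C \<xi>"
proof -
  have comm': "\<pi> x (U' \<xi>) = U' (\<pi> x \<xi>)" if "x \<in> carrier B" for x \<xi>
    by (metis U(2,3) comm that)
  have rep: "\<pi> x (\<xi> + \<eta>) = \<pi> x \<xi> + \<pi> x \<eta>" "\<pi> x (\<xi> - \<eta>) = \<pi> x \<xi> - \<pi> x \<eta>"
    "\<pi> x (c *\<^sub>C \<xi>) = c *\<^sub>C \<pi> x \<xi>"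
    if "x \<in> carrier B" for x \<xi> \<eta> c
    using bounded_linear_rep[OF that] is_adjoint_clinear[OF is_adjoint_op[OF that]] that
    by (simp_all add: bounded_linear.linear linear_add linear_diff)
  have "is_adjoint (U + U') (U + U')"
    using is_adjoint_plus[OF U(1) is_adjoint_sym[OF U(1)]] by (simp add: add.commute)
  moreover have "\<pi> x ((U + U') \<xi>) = (U + U') (\<pi> x \<xi>)" if "x \<in> carrier B" for x \<xi>
    using that by (simp add: blinfun.bilinear_simps comm comm' rep)
  ultimately obtain a where a: "\<And>\<xi>. (U + U') \<xi> = a *\<^sub>R \<xi>"
    using schur_selfadjoint[OF irr] by blast
  have "is_adjoint (cscale \<i> o\<^sub>L (U - U')) (cscale (cnj \<i>) o\<^sub>L (U' - U))"
    by (intro is_adjoint_cscale_compose is_adjoint_minus U(1) is_adjoint_sym[OF U(1)])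
  moreover have "cscale (cnj \<i>) o\<^sub>L (U' - U) = cscale \<i> o\<^sub>L (U - U')"
  proof (rule blinfun_eqI)
    fix \<xi>
    have "cnj \<i> *\<^sub>C (U' \<xi> - U \<xi>) = \<i> *\<^sub>C (- 1) *\<^sub>C (U' \<xi> - U \<xi>)"
      by (simp add: scaleC_scaleC)
    also have "(- 1) *\<^sub>C (U' \<xi> - U \<xi>) = U \<xi> - U' \<xi>"
      using scaleC_of_real[of "- 1" "U' \<xi> - U \<xi>"] by simp
    finally show "(cscale (cnj \<i>) o\<^sub>L (U' - U)) \<xi> = (cscale \<i> o\<^sub>L (U - U')) \<xi>"
      by (simp add: blinfun.bilinear_simps)
  qed
  ultimately have "is_adjoint (cscale \<i> o\<^sub>L (U - U')) (cscale \<i> o\<^sub>L (U - U'))"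
    by simp
  moreover have "\<pi> x ((cscale \<i> o\<^sub>L (U - U')) \<xi>) = (cscale \<i> o\<^sub>L (U - U')) (\<pi> x \<xi>)"
    if "x \<in> carrier B" for x \<xi>
    using that by (simp add: blinfun.bilinear_simps comm comm' rep)
  ultimately obtain b where b: "\<And>\<xi>. (cscale \<i> o\<^sub>L (U - U')) \<xi> = b *\<^sub>R \<xi>"
    using schur_selfadjoint[OF irr] by blast
  define c where "c = (complex_of_real a - \<i> * complex_of_real b) / 2"
  have U_eq: "U \<xi> = c *\<^sub>C \<xi>" for \<xi>
  proof -
    have "U \<xi> - U' \<xi> = (- \<i>) *\<^sub>C \<i> *\<^sub>C (U \<xi> - U' \<xi>)"
      by (simp add: scaleC_scaleC scaleC_one)
    also have "\<dots> = (- \<i>) *\<^sub>C complex_of_real b *\<^sub>C \<xi>"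
      using b[of \<xi>] by (simp add: blinfun.bilinear_simps scaleC_of_real)
    finally have diff: "U \<xi> - U' \<xi> = (- \<i>) *\<^sub>C complex_of_real b *\<^sub>C \<xi>" .
    have "U \<xi> + U' \<xi> = complex_of_real a *\<^sub>C \<xi>"
      using a[of \<xi>] by (simp add: blinfun.bilinear_simps scaleC_of_real)
    then have "(U \<xi> + U' \<xi>) + (U \<xi> - U' \<xi>) = (complex_of_real a + (- \<i>) * complex_of_real b) *\<^sub>C \<xi>"
      by (simp only: diff scaleC_scaleC scaleC_add_left)
    also have "(U \<xi> + U' \<xi>) + (U \<xi> - U' \<xi>) = complex_of_real 2 *\<^sub>C U \<xi>"
      by (simp only: scaleC_of_real) (simp add: scaleR_2)
    finally have "(1 / 2) *\<^sub>C complex_of_real 2 *\<^sub>C U \<xi> = (1 / 2) *\<^sub>C (complex_of_real a + (- \<i>) * complex_of_real b) *\<^sub>C \<xi>"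
      by simp
    then show ?thesis
      by (simp add: scaleC_scaleC scaleC_one c_def)
  qed
  moreover have "cmod c = 1"
  proof -
    obtain \<xi> :: 'h where \<xi>: "\<xi> \<noteq> 0" using nonzero_vector by blast
    have "inner (U \<xi>) (U \<xi>) = inner \<xi> \<xi>"
      using U by (simp add: is_adjoint_def flip: Re_cinner)
    then have "norm (U \<xi>) = norm \<xi>" by (simp add: norm_eq)
    then show ?thesis using \<xi> by (simp add: U_eq norm_scaleC)
  qed
  ultimately show thesis by (intro that)
qed

end

section \<open>Covariant pairs on a Hilbert space\<close>

lemma unital_star_homD:
  assumes "h \<in> unital_star_hom A B"
  shows "x \<in> carrier A \<Longrightarrow> h x \<in> carrier B" "h \<one>\<^bsub>A\<^esub> = \<one>\<^bsub>B\<^esub>"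
    "x \<in> carrier A \<Longrightarrow> y \<in> carrier A \<Longrightarrow> h (x \<oplus>\<^bsub>A\<^esub> y) = h x \<oplus>\<^bsub>B\<^esub> h y"
    "x \<in> carrier A \<Longrightarrow> y \<in> carrier A \<Longrightarrow> h (x \<otimes>\<^bsub>A\<^esub> y) = h x \<otimes>\<^bsub>B\<^esub> h y"
    "x \<in> carrier A \<Longrightarrow> h (c \<odot>\<^bsub>A\<^esub> x) = c \<odot>\<^bsub>B\<^esub> h x"
    "x \<in> carrier A \<Longrightarrow> h (star A x) = star B (h x)"
  using assms by (auto simp: unital_star_hom_def ring_hom_def)

lemma unital_star_homI:
  assumes "\<And>x. x \<in> carrier A \<Longrightarrow> h x \<in> carrier B" "h \<one>\<^bsub>A\<^esub> = \<one>\<^bsub>B\<^esub>"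
    "\<And>x y. x \<in> carrier A \<Longrightarrow> y \<in> carrier A \<Longrightarrow> h (x \<oplus>\<^bsub>A\<^esub> y) = h x \<oplus>\<^bsub>B\<^esub> h y"
    "\<And>x y. x \<in> carrier A \<Longrightarrow> y \<in> carrier A \<Longrightarrow> h (x \<otimes>\<^bsub>A\<^esub> y) = h x \<otimes>\<^bsub>B\<^esub> h y"
    "\<And>c x. x \<in> carrier A \<Longrightarrow> h (c \<odot>\<^bsub>A\<^esub> x) = c \<odot>\<^bsub>B\<^esub> h x"
    "\<And>x. x \<in> carrier A \<Longrightarrow> h (star A x) = star B (h x)"
  shows "h \<in> unital_star_hom A B"
  using assms by (auto simp: unital_star_hom_def ring_hom_def)

lemma unital_star_hom_comp:
  "g \<in> unital_star_hom A B \<Longrightarrow> h \<in> unital_star_hom B C \<Longrightarrow> (\<lambda>x. h (g x)) \<in> unital_star_hom A C"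
  by (rule unital_star_homI) (simp_all add: unital_star_homD)

lemma bounded_clinear_adjointable: "T \<in> adjointable \<Longrightarrow> bounded_clinear (blinfun_apply T)"
  by (simp add: bounded_clinear_def blinfun.bounded_linear_right
      is_adjoint_clinear[OF is_adjoint_adjoint])

lemma representation_hom_operator_algebra:
  fixes h :: "'b \<Rightarrow> 'h::complex_hilbert_space \<Rightarrow>\<^sub>L 'h"
  assumes h: "h \<in> unital_star_hom B operator_algebra" and nonzero: "\<exists>\<xi>::'h. \<xi> \<noteq> 0"
  shows "representation B (\<lambda>x. blinfun_apply (h x))"
proof -
  have "h x \<in> adjointable" if "x \<in> carrier B" for x
    using unital_star_homD(1)[OF h that] by simp
  then have "cinner (h x \<xi>) \<eta> = cinner \<xi> (h (star B x) \<eta>)" if "x \<in> carrier B" for x \<xi> \<eta>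
    using that is_adjoint_adjoint[of "h x"] by (simp add: unital_star_homD[OF h] is_adjoint_def)
  moreover have "bounded_clinear (h x)" if "x \<in> carrier B" for x
    using unital_star_homD(1)[OF h that] by (simp add: bounded_clinear_adjointable)
  ultimately show ?thesis
    using nonzero unfolding representation_def
    by (auto simp: unital_star_homD[OF h] blinfun.bilinear_simps fun_eq_iff)
qed

lemma representation_comp_hom:
  assumes "representation B \<pi>" "h \<in> unital_star_hom A B"
  shows "representation A (\<lambda>x. \<pi> (h x))"
  using assms(1) unfolding representation_def
  by (simp add: unital_star_homD[OF assms(2)])

text \<open>\<open>V'\<close> is both adjoint and inverse of \<open>V\<close>. Keeping the scalar
  \<open>c\<close> general lets one construction serve both directions: \<open>c\<close> is z^2 when
  a representation is extended to the crossed product by the integers, and 1 when one for the group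
  of order two is built.\<close>

locale covariant_operators = cstar_representation A \<phi>
  for A :: "'a cstar_algebra" (structure) and \<phi> :: "'a \<Rightarrow> 'h::complex_hilbert_space \<Rightarrow> 'h" +
  fixes \<sigma> :: "'a \<Rightarrow> 'a" and V V' :: "'h \<Rightarrow>\<^sub>L 'h" and c :: complex
  assumes \<sigma>: "\<sigma> \<in> unital_star_hom A A" and \<sigma>_\<sigma>: "a \<in> carrier A \<Longrightarrow> \<sigma> (\<sigma> a) = a"
    and adjoint_V: "is_adjoint V V'" and V_V': "V (V' \<xi>) = \<xi>" and V'_V: "V' (V \<xi>) = \<xi>"
    and V_V: "V (V \<xi>) = c *\<^sub>C \<xi>" and cmod_c: "cmod c = 1"
    and covariant: "a \<in> carrier A \<Longrightarrow> V (\<phi> a (V' \<xi>)) = \<phi> (\<sigma> a) \<xi>"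
begin

lemmas \<sigma>_closed = unital_star_homD(1)[OF \<sigma>]

lemma V_rep: "a \<in> carrier A \<Longrightarrow> V (\<phi> a \<xi>) = \<phi> (\<sigma> a) (V \<xi>)"
  using covariant[of a "V \<xi>"] by (simp add: V'_V)

text \<open>From V^2 = c the inverse of \<open>V\<close> is a multiple of \<open>V\<close>, which is
  why adjoints stay in the two-term form below.\<close>

lemma V'_eq: "V' \<xi> = cnj c *\<^sub>C V \<xi>"
proof -
  have "V \<xi> = c *\<^sub>C V' \<xi>"
    by (metis V_V V_V')
  moreover have "cnj c * c = 1"
    using cmod_c complex_norm_square[of c] by (simp add: mult.commute)
  ultimately show ?thesis by (simp add: scaleC_scaleC scaleC_one)
qed

text \<open>The coefficients need not be determined by the operator, so operators are coded by
  chosen coefficients later on.\<close>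

definition elt :: "'a \<Rightarrow> 'a \<Rightarrow> 'h \<Rightarrow>\<^sub>L 'h" where
  "elt a b = op a + (op b o\<^sub>L V)"

lemma apply_elt: "a \<in> carrier A \<Longrightarrow> b \<in> carrier A \<Longrightarrow> elt a b \<xi> = \<phi> a \<xi> + \<phi> b (V \<xi>)"
  by (simp add: elt_def blinfun.bilinear_simps)

lemma rep_add_right: "a \<in> carrier A \<Longrightarrow> \<phi> a (\<xi> + \<eta>) = \<phi> a \<xi> + \<phi> a \<eta>"
  using bounded_linear_rep by (simp add: bounded_linear.linear linear_add)

lemma rep_zero: "\<phi> \<zero> \<xi> = 0"
  using rep_add[of \<zero> \<zero> \<xi>] by simp

lemma elt_one: "elt \<one> \<zero> = id_blinfun"
  by (rule blinfun_eqI) (simp add: apply_elt rep_one rep_zero)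

lemma elt_add:
  "\<lbrakk>a \<in> carrier A; b \<in> carrier A; a' \<in> carrier A; b' \<in> carrier A\<rbrakk>
    \<Longrightarrow> elt a b + elt a' b' = elt (a \<oplus> a') (b \<oplus> b')"
  by (rule blinfun_eqI) (simp add: apply_elt rep_add blinfun.add_left)

lemma elt_smult:
  "a \<in> carrier A \<Longrightarrow> b \<in> carrier A \<Longrightarrow> (cscale d o\<^sub>L elt a b) = elt (d \<odot> a) (d \<odot> b)"
  by (rule blinfun_eqI) (simp add: apply_elt rep_smult scaleC_add_right smult_closed)

text \<open>Moving \<open>V\<close> past a coefficient applies \<sigma> to it, and V^2 contributes
  the factor \<open>c\<close>.\<close>

lemma elt_mult:
  "\<lbrakk>a \<in> carrier A; b \<in> carrier A; a' \<in> carrier A; b' \<in> carrier A\<rbrakk>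
    \<Longrightarrow> (elt a b o\<^sub>L elt a' b') = elt (a \<otimes> a' \<oplus> c \<odot> (b \<otimes> \<sigma> b')) (a \<otimes> b' \<oplus> b \<otimes> \<sigma> a')"
  by (rule blinfun_eqI)
    (simp add: apply_elt rep_add rep_mult rep_smult smult_closed \<sigma>_closed rep_add_right rep_scaleC V_rep V_V
      blinfun.add_right)

lemma is_adjoint_elt:
  assumes ab: "a \<in> carrier A" "b \<in> carrier A"
  shows "is_adjoint (elt a b) (elt (star A a) (cnj c \<odot> \<sigma> (star A b)))"
proof -
  have "is_adjoint (elt a b) (op (star A a) + (V' o\<^sub>L op (star A b)))"
    unfolding elt_def by (intro is_adjoint_plus is_adjoint_compose is_adjoint_op adjoint_V ab)
  also have "op (star A a) + (V' o\<^sub>L op (star A b)) = elt (star A a) (cnj c \<odot> \<sigma> (star A b))"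
    using ab by (intro blinfun_eqI)
      (simp add: apply_elt star_closed smult_closed \<sigma>_closed rep_smult blinfun.add_left V'_eq V_rep)
  finally show ?thesis .
qed

section \<open>The norm closure of the two-term operators and its coding by sequences\<close>

definition elts :: "('h \<Rightarrow>\<^sub>L 'h) set" where
  "elts = (\<lambda>(a, b). elt a b) ` (carrier A \<times> carrier A)"

lemma eltsI: "a \<in> carrier A \<Longrightarrow> b \<in> carrier A \<Longrightarrow> elt a b \<in> elts"
  by (auto simp: elts_def)

lemma closure_eltsI: "(\<And>n. u n \<in> elts) \<Longrightarrow> u \<longlonglongrightarrow> T \<Longrightarrow> T \<in> closure elts"
  unfolding closure_sequential by blast

lemma closure_elts_adjointable: "T \<in> closure elts \<Longrightarrow> T \<in> adjointable \<and> operator_adjoint T \<in> closure elts"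
proof -
  assume "T \<in> closure elts"
  then obtain u where u: "\<And>n. u n \<in> elts" "u \<longlonglongrightarrow> T"
    unfolding closure_sequential by blast
  have elts: "S \<in> adjointable" "operator_adjoint S \<in> elts" if S: "S \<in> elts" for S
  proof -
    obtain a b where ab: "S = elt a b" "a \<in> carrier A" "b \<in> carrier A"
      using S by (auto simp: elts_def)
    then have adj: "is_adjoint S (elt (star A a) (cnj c \<odot> \<sigma> (star A b)))"
      by (simp add: is_adjoint_elt)
    then show "S \<in> adjointable" by (rule adjointableI)
    show "operator_adjoint S \<in> elts"
      unfolding adjoint_eqI[OF adj] using ab by (intro eltsI star_closed smult_closed \<sigma>_closed)
  qed
  have "u n \<in> adjointable" for n
    using u(1) by (rule elts(1))
  note lim = adjointable_tendsto[OF u(2) this]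
  have "operator_adjoint (u n) \<in> elts" for n
    using u(1) by (rule elts(2))
  then show ?thesis
    using lim(1) closure_eltsI[OF _ lim(2)] by simp
qed

lemma subalgebra_closure_elts: "unital_cstar_subalgebra operator_algebra (closure elts)"
  unfolding unital_cstar_subalgebra_def operator_algebra_simps
proof (intro conjI ballI allI impI)
  show "closure elts \<subseteq> adjointable"
    using closure_elts_adjointable by blast
  show "id_blinfun \<in> closure elts"
    using eltsI[of \<one> \<zero>] closure_subset by (auto simp: elt_one)
  fix T S assume T: "T \<in> closure elts" and S: "S \<in> closure elts"
  obtain u v where uv: "\<And>n. u n \<in> elts" "u \<longlonglongrightarrow> T" "\<And>n. v n \<in> elts" "v \<longlonglongrightarrow> S"
    using T S unfolding closure_sequential by blast
  have "u n + v n \<in> elts" for n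
    using uv(1)[of n] uv(3)[of n] by (auto simp: elts_def elt_add intro!: eltsI[unfolded elts_def])
  then show "T + S \<in> closure elts"
    using tendsto_add[OF uv(2,4)] by (rule closure_eltsI)
  have "(u n o\<^sub>L v n) \<in> elts" for n
    using uv(1)[of n] uv(3)[of n]
    by (auto simp: elts_def elt_mult \<sigma>_closed smult_closed intro!: eltsI[unfolded elts_def])
  then show "(T o\<^sub>L S) \<in> closure elts"
    using bounded_bilinear.tendsto[OF bounded_bilinear_blinfun_compose uv(2,4)] by (rule closure_eltsI)
next
  fix T d assume T: "T \<in> closure elts"
  then show "operator_adjoint T \<in> closure elts"
    using closure_elts_adjointable by blast
  obtain u where u: "\<And>n. u n \<in> elts" "u \<longlonglongrightarrow> T"
    using T unfolding closure_sequential by blast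
  have "(cscale d o\<^sub>L u n) \<in> elts" for n
    using u(1)[of n] by (auto simp: elts_def elt_smult smult_closed intro!: eltsI[unfolded elts_def])
  then show "(cscale d o\<^sub>L T) \<in> closure elts"
    using bounded_bilinear.tendsto[OF bounded_bilinear_blinfun_compose tendsto_const u(2)] by (rule closure_eltsI)
next
  fix T assume T: "T \<in> adjointable"
    and near: "\<forall>e>0. \<exists>S\<in>closure elts. norm (T \<ominus>\<^bsub>operator_algebra\<^esub> S) < e"
  have "\<exists>S\<in>closure elts. dist S T < e" if "e > 0" for e
    using near that T closure_elts_adjointable
    by (metis dist_commute dist_norm operator_algebra_minus)
  then have "T \<in> closure (closure elts)"
    by (simp only: closure_approachable) blast
  then show "T \<in> closure elts" by simp
qed

text \<open>
  An operator in the closure is encoded by the interleaving of two coefficient sequences; this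
  realises the C*-algebra generated by the covariant pair on a set of sequences in \<open>A\<close>.
\<close>

definition codes :: "(nat \<Rightarrow> 'a) \<Rightarrow> ('h \<Rightarrow>\<^sub>L 'h) \<Rightarrow> bool" where
  "codes s T \<longleftrightarrow> (\<lambda>n. elt (s (2 * n)) (s (2 * n + 1))) \<longlonglongrightarrow> T"

definition code_of :: "('h \<Rightarrow>\<^sub>L 'h) \<Rightarrow> nat \<Rightarrow> 'a" where
  "code_of T = (SOME s. codes s T)"

lemma codes_code_of:
  assumes "T \<in> closure elts"
  shows "codes (code_of T) T"
proof -
  obtain u where u: "\<And>n. u n \<in> elts" "u \<longlonglongrightarrow> T"
    using assms unfolding closure_sequential by blast
  have "\<exists>a b. u n = elt a b" for n
    using u(1)[of n] by (auto simp: elts_def)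
  then obtain a b where ab: "\<And>n. u n = elt (a n) (b n)" by metis
  define s where "s n = (if even n then a (n div 2) else b (n div 2))" for n
  have "u = (\<lambda>n. elt (s (2 * n)) (s (2 * n + 1)))"
    by (simp add: ab s_def fun_eq_iff)
  then have "codes s T"
    using u(2) by (simp add: codes_def)
  then show ?thesis unfolding code_of_def by (rule someI[of "\<lambda>s. codes s T"])
qed

text \<open>A code determines its operator as the limit of the sequence it describes.\<close>

lemma inj_on_code_of: "inj_on code_of (closure elts)"
  by (rule inj_onI) (metis LIMSEQ_unique codes_code_of codes_def)

text \<open>\<open>image.D\<close> is the coded copy of the closure and can serve as a test algebra
  in the universal properties.\<close>

sublocale image: cstar_subalgebra_image operator_algebra "closure elts" code_of
  by (intro cstar_subalgebra_image.intro unital_cstar_operator_algebra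
      cstar_subalgebra_image_axioms.intro subalgebra_closure_elts inj_on_code_of)

section \<open>The covariant pair in the coded algebra, and the induced representations\<close>

lemma op_mem: "a \<in> carrier A \<Longrightarrow> op a \<in> closure elts"
proof -
  assume a: "a \<in> carrier A"
  then have "op a = elt a \<zero>"
    by (intro blinfun_eqI) (simp add: apply_elt rep_zero)
  then show ?thesis using a eltsI[of a \<zero>] closure_subset by auto
qed

lemma V_mem: "V \<in> closure elts"
proof -
  have "V = elt \<zero> \<one>"
    by (intro blinfun_eqI) (simp add: apply_elt rep_zero rep_one)
  then show ?thesis using eltsI[of \<zero> \<one>] closure_subset by auto
qed

lemma V'_mem: "V' \<in> closure elts"
  using image.closed(4)[OF V_mem] by (simp add: adjoint_eqI[OF adjoint_V])

lemma code_hom: "(\<lambda>a. code_of (op a)) \<in> unital_star_hom A image.D"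
proof (rule unital_star_homI)
  have "op \<one> = id_blinfun"
    by (rule blinfun_eqI) (simp add: rep_one)
  then show "code_of (op \<one>) = \<one>\<^bsub>image.D\<^esub>" by simp
next
  fix a b assume "a \<in> carrier A" "b \<in> carrier A"
  moreover from this have "op (a \<oplus> b) = op a + op b" "op (a \<otimes> b) = op a o\<^sub>L op b"
    by (auto intro!: blinfun_eqI simp: blinfun.add_left rep_add rep_mult)
  ultimately show "code_of (op (a \<oplus> b)) = code_of (op a) \<oplus>\<^bsub>image.D\<^esub> code_of (op b)"
    "code_of (op (a \<otimes> b)) = code_of (op a) \<otimes>\<^bsub>image.D\<^esub> code_of (op b)"
    by (simp_all add: op_mem)
next
  fix a d assume "a \<in> carrier A"
  moreover from this have "op (d \<odot> a) = cscale d o\<^sub>L op a"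
    by (intro blinfun_eqI) (simp add: rep_smult smult_closed)
  ultimately show "code_of (op (d \<odot> a)) = d \<odot>\<^bsub>image.D\<^esub> code_of (op a)"
    by (simp add: op_mem)
next
  fix a assume "a \<in> carrier A"
  then show "code_of (op a) \<in> carrier image.D"
    "code_of (op (star A a)) = star image.D (code_of (op a))"
    by (simp_all add: op_mem adjoint_eqI[OF is_adjoint_op])
qed

lemma covariant_code: "covariant_Z A \<sigma> image.D (\<lambda>a. code_of (op a)) (code_of V)"
  unfolding covariant_Z_def
proof (intro conjI ballI code_hom)
  have star_V: "operator_adjoint V = V'" by (rule adjoint_eqI[OF adjoint_V])
  have "V' o\<^sub>L V = id_blinfun" "V o\<^sub>L V' = id_blinfun"
    by (auto intro!: blinfun_eqI simp: V_V' V'_V)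
  then show "code_of V \<in> unitaries image.D"
    by (simp add: unitaries_def V_mem V'_mem star_V)
  fix a assume a: "a \<in> carrier A"
  then have "V o\<^sub>L op a o\<^sub>L V' = op (\<sigma> a)"
    by (intro blinfun_eqI) (simp add: covariant \<sigma>_closed)
  moreover have "V o\<^sub>L op a \<in> closure elts"
    using image.closed(3)[OF V_mem op_mem[OF a]] by simp
  ultimately show "code_of V \<otimes>\<^bsub>image.D\<^esub> code_of (op a) \<otimes>\<^bsub>image.D\<^esub> star image.D (code_of V) = code_of (op (\<sigma> a))"
    using a by (simp add: V_mem V'_mem op_mem star_V)
qed

lemma covariant_code_Z2:
  assumes "c = 1"
  shows "covariant_Z2 A \<sigma> image.D (\<lambda>a. code_of (op a)) (code_of V)"
proof -
  have "V o\<^sub>L V = id_blinfun"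
    by (intro blinfun_eqI) (simp add: V_V assms scaleC_one)
  then show ?thesis
    unfolding covariant_Z2_def by (simp add: covariant_code V_mem)
qed

text \<open>Decoding the values of \<Phi> gives operators. This step is common to both groups, which
  differ only in the universal property that supplies \<Phi>.\<close>

lemma representation_extending:
  assumes \<Phi>: "\<Phi> \<in> unital_star_hom B image.D"
    and \<Phi>_\<iota>: "\<forall>a\<in>carrier A. \<Phi> (\<iota> a) = code_of (op a)" and \<Phi>_W: "\<Phi> W = code_of V"
  obtains \<pi> where "representation B \<pi>" "\<And>a. a \<in> carrier A \<Longrightarrow> \<pi> (\<iota> a) = \<phi> a" "\<pi> W = blinfun_apply V"
proof
  let ?\<pi> = "\<lambda>x. blinfun_apply (inv_into (closure elts) code_of (\<Phi> x))"
  show "representation B ?\<pi>"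
    by (intro representation_hom_operator_algebra nonzero_vector
        unital_star_hom_comp[OF \<Phi> image.inv_into_hom])
  show "?\<pi> (\<iota> a) = \<phi> a" if "a \<in> carrier A" for a
    using that \<Phi>_\<iota> by (simp add: inv_into_f_f[OF inj_on_code_of] op_mem)
  show "?\<pi> W = blinfun_apply V"
    using \<Phi>_W by (simp add: inv_into_f_f[OF inj_on_code_of] V_mem)
qed

lemma extends_to_crossed_product_Z:
  assumes crossed: "crossed_product_Z A \<sigma> B \<iota> W"
  obtains \<pi> where "representation B \<pi>" "\<And>a. a \<in> carrier A \<Longrightarrow> \<pi> (\<iota> a) = \<phi> a" "\<pi> W = blinfun_apply V"
proof -
  obtain \<Phi> where "\<Phi> \<in> unital_star_hom B image.D"
    "\<forall>a\<in>carrier A. \<Phi> (\<iota> a) = code_of (op a)" "\<Phi> W = code_of V"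
    using crossed image.unital_cstar_algebra_image covariant_code
    unfolding crossed_product_Z_def by blast
  then show thesis
    by (rule representation_extending) (rule that)
qed

lemma extends_to_crossed_product_Z2:
  assumes crossed: "crossed_product_Z2 A \<sigma> B \<iota> W" and c: "c = 1"
  obtains \<pi> where "representation B \<pi>" "\<And>a. a \<in> carrier A \<Longrightarrow> \<pi> (\<iota> a) = \<phi> a" "\<pi> W = blinfun_apply V"
proof -
  obtain \<Phi> where "\<Phi> \<in> unital_star_hom B image.D"
    "\<forall>a\<in>carrier A. \<Phi> (\<iota> a) = code_of (op a)" "\<Phi> W = code_of V"
    using crossed image.unital_cstar_algebra_image covariant_code_Z2[OF c]
    unfolding crossed_product_Z2_def by blast
  then show thesis
    by (rule representation_extending) (rule that)
qed

end

section \<open>Irreducible representations of the crossed products\<close>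

lemma cstar_representationI:
  "unital_cstar_algebra B \<Longrightarrow> representation B \<pi> \<Longrightarrow> cstar_representation B \<pi>"
  by (intro cstar_representation.intro cstar_representation_axioms.intro)

lemma covariant_ZD:
  assumes "covariant_Z A \<sigma> D \<phi> V"
  shows "\<phi> \<in> unital_star_hom A D" "V \<in> carrier D" "star D V \<otimes>\<^bsub>D\<^esub> V = \<one>\<^bsub>D\<^esub>" "V \<otimes>\<^bsub>D\<^esub> star D V = \<one>\<^bsub>D\<^esub>"
    "a \<in> carrier A \<Longrightarrow> V \<otimes>\<^bsub>D\<^esub> \<phi> a \<otimes>\<^bsub>D\<^esub> star D V = \<phi> (\<sigma> a)"
  using assms by (auto simp: covariant_Z_def unitaries_def)

lemma order_two_automorphismD:
  assumes "order_two_automorphism A \<sigma>"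
  shows "\<sigma> \<in> unital_star_hom A A" "a \<in> carrier A \<Longrightarrow> \<sigma> (\<sigma> a) = a"
  using assms by (auto simp: order_two_automorphism_def)

context cstar_representation
begin

lemma covariant_rep:
  assumes "covariant_Z A \<sigma> B \<iota> W"
  shows "\<pi> W (\<pi> (star B W) \<xi>) = \<xi>" "\<pi> (star B W) (\<pi> W \<xi>) = \<xi>"
    "a \<in> carrier A \<Longrightarrow> \<pi> W (\<pi> (\<iota> a) (\<pi> (star B W) \<xi>)) = \<pi> (\<iota> (\<sigma> a)) \<xi>"
    "a \<in> carrier A \<Longrightarrow> \<pi> W (\<pi> (\<iota> a) \<xi>) = \<pi> (\<iota> (\<sigma> a)) (\<pi> W \<xi>)"
proof -
  note cov = covariant_ZD[OF assms]
  note closed = cov(2) star_closed[OF cov(2)] unital_star_homD(1)[OF cov(1)]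
  show "\<pi> W (\<pi> (star B W) \<xi>) = \<xi>" and inv: "\<pi> (star B W) (\<pi> W \<xi>) = \<xi>" for \<xi>
    using closed by (simp_all add: cov rep_one flip: rep_mult)
  show *: "\<pi> W (\<pi> (\<iota> a) (\<pi> (star B W) \<xi>)) = \<pi> (\<iota> (\<sigma> a)) \<xi>" if "a \<in> carrier A" for a \<xi>
    using closed that by (simp add: rep_mult flip: cov(5))
  show "\<pi> W (\<pi> (\<iota> a) \<xi>) = \<pi> (\<iota> (\<sigma> a)) (\<pi> W \<xi>)" if "a \<in> carrier A"
    using *[OF that, of "\<pi> W \<xi>"] by (simp add: inv)
qed

text \<open>A scalar of modulus one cancels against its conjugate in V a V*, so covariance survives
  the scaling; only the square changes, by the factor z^2.\<close>

lemma covariant_operators_scaled: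
  assumes A: "unital_cstar_algebra A" and \<sigma>: "order_two_automorphism A \<sigma>"
    and cov: "covariant_Z A \<sigma> B \<iota> W" and W2: "\<And>\<xi>. \<pi> W (\<pi> W \<xi>) = d *\<^sub>C \<xi>"
    and z: "cmod z = 1" and d: "cmod d = 1"
  shows "covariant_operators A (\<lambda>a. \<pi> (\<iota> a)) \<sigma> (cscale z o\<^sub>L op W) (cscale (cnj z) o\<^sub>L op (star B W)) (z\<^sup>2 * d)"
proof -
  note \<iota> = covariant_ZD(1)[OF cov] and W = covariant_ZD(2)[OF cov]
  have zz: "z * cnj z = 1" "cnj z * z = 1"
    using z complex_norm_square[of z] by (simp_all add: mult.commute)
  interpret R: cstar_representation A "\<lambda>a. \<pi> (\<iota> a)"
    by (intro cstar_representationI A representation_comp_hom[OF representation \<iota>])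
  show ?thesis
  proof
    show "is_adjoint (cscale z o\<^sub>L op W) (cscale (cnj z) o\<^sub>L op (star B W))"
      by (intro is_adjoint_cscale_compose is_adjoint_op W)
    show "cmod (z\<^sup>2 * d) = 1"
      using z d by (simp add: norm_mult norm_power)
  qed (simp_all add: order_two_automorphismD[OF \<sigma>] W star_closed rep_scaleC scaleC_scaleC zz scaleC_one
      covariant_rep[OF cov] W2 power2_eq_square unital_star_homD(1)[OF \<iota>] mult_ac)
qed

end

theorem proposition2p12:
  fixes A :: "'a cstar_algebra" and \<sigma> :: "'a \<Rightarrow> 'a"
    and B\<^sub>2 :: "'b cstar_algebra" and \<iota>\<^sub>2 :: "'a \<Rightarrow> 'b" and W :: 'b
    and B\<^sub>Z :: "'c cstar_algebra" and \<iota>\<^sub>Z :: "'a \<Rightarrow> 'c" and W\<^sub>Z :: 'c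
  assumes "unital_cstar_algebra A"
    and "order_two_automorphism A \<sigma>"
    and "crossed_product_Z2 A \<sigma> B\<^sub>2 \<iota>\<^sub>2 W"
    and "crossed_product_Z A \<sigma> B\<^sub>Z \<iota>\<^sub>Z W\<^sub>Z"
  shows "(\<forall>(\<pi>\<^sub>2 :: 'b \<Rightarrow> 'h::complex_hilbert_space \<Rightarrow> 'h) z.
            irreducible_representation B\<^sub>2 \<pi>\<^sub>2 \<and> cmod z = 1 \<longrightarrow>
            (\<exists>!\<pi>. \<pi> \<in> extensional (carrier B\<^sub>Z) \<and> representation B\<^sub>Z \<pi> \<and>
                  (\<forall>a\<in>carrier A. \<pi> (\<iota>\<^sub>Z a) = \<pi>\<^sub>2 (\<iota>\<^sub>2 a)) \<and>
                  \<pi> W\<^sub>Z = (\<lambda>\<xi>. z *\<^sub>C \<pi>\<^sub>2 W \<xi>)))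
       \<and> (\<forall>\<pi> :: 'c \<Rightarrow> 'h \<Rightarrow> 'h.
            irreducible_representation B\<^sub>Z \<pi> \<longrightarrow>
            (\<exists>\<pi>\<^sub>2 z. irreducible_representation B\<^sub>2 \<pi>\<^sub>2 \<and> cmod z = 1 \<and>
                  (\<forall>a\<in>carrier A. \<pi> (\<iota>\<^sub>Z a) = \<pi>\<^sub>2 (\<iota>\<^sub>2 a)) \<and>
                  \<pi> W\<^sub>Z = (\<lambda>\<xi>. z *\<^sub>C \<pi>\<^sub>2 W \<xi>)))"
proof (intro conjI allI impI)
  note A = assms(1) and \<sigma> = assms(2)
  have B\<^sub>Z: "unital_cstar_algebra B\<^sub>Z" and covZ: "covariant_Z A \<sigma> B\<^sub>Z \<iota>\<^sub>Z W\<^sub>Z"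
    and genZ: "cstar_generated_by B\<^sub>Z (\<iota>\<^sub>Z ` carrier A \<union> {W\<^sub>Z})"
    using assms(4) by (simp_all add: crossed_product_Z_def)
  have B\<^sub>2: "unital_cstar_algebra B\<^sub>2" and cov2: "covariant_Z A \<sigma> B\<^sub>2 \<iota>\<^sub>2 W"
    and W2: "W \<otimes>\<^bsub>B\<^sub>2\<^esub> W = \<one>\<^bsub>B\<^sub>2\<^esub>"
    using assms(3) by (simp_all add: crossed_product_Z2_def covariant_Z2_def)
  note \<iota>\<^sub>Z = covariant_ZD(1)[OF covZ] and W\<^sub>Z = covariant_ZD(2)[OF covZ]
  note \<iota>\<^sub>2 = covariant_ZD(1)[OF cov2] and W = covariant_ZD(2)[OF cov2]

  {
    fix \<pi>\<^sub>2 :: "'b \<Rightarrow> 'h \<Rightarrow> 'h" and z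
    assume "irreducible_representation B\<^sub>2 \<pi>\<^sub>2 \<and> cmod z = 1"
    then have z: "cmod z = 1" and "representation B\<^sub>2 \<pi>\<^sub>2"
      by (simp_all add: irreducible_representation_def)
    then interpret R: cstar_representation B\<^sub>2 \<pi>\<^sub>2
      by (intro cstar_representationI B\<^sub>2)
    have "\<pi>\<^sub>2 W (\<pi>\<^sub>2 W \<xi>) = 1 *\<^sub>C \<xi>" for \<xi>
      using W by (simp add: W2 R.rep_one scaleC_one flip: R.rep_mult)
    from R.covariant_operators_scaled[OF A \<sigma> cov2 this z]
    interpret C: covariant_operators A "\<lambda>a. \<pi>\<^sub>2 (\<iota>\<^sub>2 a)" \<sigma> "cscale z o\<^sub>L R.op W"
      "cscale (cnj z) o\<^sub>L R.op (star B\<^sub>2 W)" "z\<^sup>2 * 1"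
      by simp
    obtain \<pi> where \<pi>: "representation B\<^sub>Z \<pi>" "\<And>a. a \<in> carrier A \<Longrightarrow> \<pi> (\<iota>\<^sub>Z a) = \<pi>\<^sub>2 (\<iota>\<^sub>2 a)"
      "\<pi> W\<^sub>Z = blinfun_apply (cscale z o\<^sub>L R.op W)"
      by (rule C.extends_to_crossed_product_Z[OF assms(4)]) (rule that)
    show "\<exists>!\<pi>. \<pi> \<in> extensional (carrier B\<^sub>Z) \<and> representation B\<^sub>Z \<pi> \<and>
        (\<forall>a\<in>carrier A. \<pi> (\<iota>\<^sub>Z a) = \<pi>\<^sub>2 (\<iota>\<^sub>2 a)) \<and> \<pi> W\<^sub>Z = (\<lambda>\<xi>. z *\<^sub>C \<pi>\<^sub>2 W \<xi>)"
    proof (rule ex1I)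
      \<comment> \<open>The values of \<pi> off the carrier are arbitrary; restriction selects the
        extensional representative, the only one for which uniqueness can hold.\<close>
      interpret Z: unital_cstar_algebra B\<^sub>Z by (rule B\<^sub>Z)
      have "representation B\<^sub>Z (restrict \<pi> (carrier B\<^sub>Z))"
        using \<pi>(1) by (simp add: representation_def Z.smult_closed Z.star_closed)
      then show "restrict \<pi> (carrier B\<^sub>Z) \<in> extensional (carrier B\<^sub>Z) \<and>
          representation B\<^sub>Z (restrict \<pi> (carrier B\<^sub>Z)) \<and>
          (\<forall>a\<in>carrier A. restrict \<pi> (carrier B\<^sub>Z) (\<iota>\<^sub>Z a) = \<pi>\<^sub>2 (\<iota>\<^sub>2 a)) \<and>
          restrict \<pi> (carrier B\<^sub>Z) W\<^sub>Z = (\<lambda>\<xi>. z *\<^sub>C \<pi>\<^sub>2 W \<xi>)"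
        using \<pi> W W\<^sub>Z by (simp add: unital_star_homD(1)[OF \<iota>\<^sub>Z] fun_eq_iff)
      fix \<rho>
      assume \<rho>: "\<rho> \<in> extensional (carrier B\<^sub>Z) \<and> representation B\<^sub>Z \<rho> \<and>
        (\<forall>a\<in>carrier A. \<rho> (\<iota>\<^sub>Z a) = \<pi>\<^sub>2 (\<iota>\<^sub>2 a)) \<and> \<rho> W\<^sub>Z = (\<lambda>\<xi>. z *\<^sub>C \<pi>\<^sub>2 W \<xi>)"
      then have "\<rho> y = \<pi> y" if "y \<in> \<iota>\<^sub>Z ` carrier A \<union> {W\<^sub>Z}" for y
        using that W by (auto simp: \<pi>(2,3))
      then have "\<rho> x = \<pi> x" if "x \<in> carrier B\<^sub>Z" for x
        using \<rho> by (intro representation_eq_if_eq_generators[OF B\<^sub>Z _ \<pi>(1) genZ _ that]) blast+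
      then show "\<rho> = restrict \<pi> (carrier B\<^sub>Z)"
        using \<rho> by (intro extensionalityI[of _ "carrier B\<^sub>Z"]) simp_all
    qed
  }

  fix \<pi> :: "'c \<Rightarrow> 'h \<Rightarrow> 'h"
  assume irr: "irreducible_representation B\<^sub>Z \<pi>"
  then interpret R: cstar_representation B\<^sub>Z \<pi>
    by (intro cstar_representationI B\<^sub>Z) (simp add: irreducible_representation_def)
  note rep_cov = R.covariant_rep[OF covZ]
  \<comment> \<open>The commutation criterion also asks for stars of generators. Those of elements
    of \<open>A\<close> are again images of elements of \<open>A\<close>, so only the star of
    \<open>W\<^sub>Z\<close> is added to the list.\<close>
  have commute: "\<pi> x (\<pi> W\<^sub>Z (\<pi> W\<^sub>Z \<xi>)) = \<pi> W\<^sub>Z (\<pi> W\<^sub>Z (\<pi> x \<xi>))"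
      if "x \<in> \<iota>\<^sub>Z ` carrier A \<union> {W\<^sub>Z, star B\<^sub>Z W\<^sub>Z}" for x \<xi>
    using that
    by (auto simp: rep_cov unital_star_homD(1)[OF order_two_automorphismD(1)[OF \<sigma>]]
        order_two_automorphismD(2)[OF \<sigma>])
  have star_\<iota>: "star B\<^sub>Z (\<iota>\<^sub>Z a) = \<iota>\<^sub>Z (star A a)" "star A a \<in> carrier A" if "a \<in> carrier A" for a
    using that by (simp_all add: unital_star_homD(6)[OF \<iota>\<^sub>Z] unital_cstar_algebra.star_closed[OF A])
  have "\<pi> x ((R.op W\<^sub>Z o\<^sub>L R.op W\<^sub>Z) \<xi>) = (R.op W\<^sub>Z o\<^sub>L R.op W\<^sub>Z) (\<pi> x \<xi>)"
    if "x \<in> carrier B\<^sub>Z" for x \<xi>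
  proof (rule R.commutes_if_commutes_generators[OF genZ that])
    show "is_adjoint (R.op W\<^sub>Z o\<^sub>L R.op W\<^sub>Z) (R.op (star B\<^sub>Z W\<^sub>Z) o\<^sub>L R.op (star B\<^sub>Z W\<^sub>Z))"
      by (intro is_adjoint_compose R.is_adjoint_op W\<^sub>Z)
  qed (use W\<^sub>Z commute star_\<iota> in auto)
  then obtain d where d: "cmod d = 1" "\<And>\<xi>. (R.op W\<^sub>Z o\<^sub>L R.op W\<^sub>Z) \<xi> = d *\<^sub>C \<xi>"
  proof (rule R.schur_unitary[OF irr, rotated 3])
    show "is_adjoint (R.op W\<^sub>Z o\<^sub>L R.op W\<^sub>Z) (R.op (star B\<^sub>Z W\<^sub>Z) o\<^sub>L R.op (star B\<^sub>Z W\<^sub>Z))"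
      by (intro is_adjoint_compose R.is_adjoint_op W\<^sub>Z)
  qed (use W\<^sub>Z R.star_closed[OF W\<^sub>Z] rep_cov in simp_all)
  have W\<^sub>Z_W\<^sub>Z: "\<pi> W\<^sub>Z (\<pi> W\<^sub>Z \<xi>) = d *\<^sub>C \<xi>" for \<xi>
    using d(2)[of \<xi>] W\<^sub>Z by simp
  \<comment> \<open>Dividing by a square root of \<open>d\<close> leaves a unitary of square one.
    The opposite root would only change the sign of \<open>\<pi>\<^sub>2 W\<close>.\<close>
  define z where "z = csqrt d"
  have z2: "z\<^sup>2 = d" by (simp add: z_def)
  have z: "cmod z = 1"
    using d(1) by (simp add: z_def)
  have zz: "z * cnj z = 1" "cnj z * z = 1"
    using z complex_norm_square[of z] by (simp_all add: mult.commute)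
  have c: "(cnj z)\<^sup>2 * d = 1"
    using zz by (simp add: power_mult_distrib[symmetric] flip: z2)
  have cz: "cmod (cnj z) = 1" using z by simp
  \<comment> \<open>Division by \<open>z\<close> is multiplication by \<open>cnj z\<close>, since
    \<open>z\<close> has modulus one.\<close>
  interpret C: covariant_operators A "\<lambda>a. \<pi> (\<iota>\<^sub>Z a)" \<sigma> "cscale (cnj z) o\<^sub>L R.op W\<^sub>Z"
    "cscale (cnj (cnj z)) o\<^sub>L R.op (star B\<^sub>Z W\<^sub>Z)" "(cnj z)\<^sup>2 * d"
    by (rule R.covariant_operators_scaled[OF A \<sigma> covZ W\<^sub>Z_W\<^sub>Z cz d(1)])
  obtain \<pi>\<^sub>2 where \<pi>\<^sub>2: "representation B\<^sub>2 \<pi>\<^sub>2" "\<And>a. a \<in> carrier A \<Longrightarrow> \<pi>\<^sub>2 (\<iota>\<^sub>2 a) = \<pi> (\<iota>\<^sub>Z a)"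
    "\<pi>\<^sub>2 W = blinfun_apply (cscale (cnj z) o\<^sub>L R.op W\<^sub>Z)"
    by (rule C.extends_to_crossed_product_Z2[OF assms(3) c]) (rule that)
  have \<pi>_W\<^sub>Z: "\<pi> W\<^sub>Z \<xi> = z *\<^sub>C \<pi>\<^sub>2 W \<xi>" for \<xi>
    using W\<^sub>Z by (simp add: \<pi>\<^sub>2(3) scaleC_scaleC zz scaleC_one)
  \<comment> \<open>Because the square of \<pi>(\<open>W\<^sub>Z\<close>) is a scalar, its adjoint
    is a multiple of it, so a complex subspace invariant under \<open>W\<^sub>Z\<close> is also
    invariant under the star.\<close>
  have star_W\<^sub>Z: "\<pi> (star B\<^sub>Z W\<^sub>Z) \<xi> = cnj d *\<^sub>C \<pi> W\<^sub>Z \<xi>" for \<xi>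
  proof -
    have "\<pi> W\<^sub>Z \<xi> = d *\<^sub>C \<pi> (star B\<^sub>Z W\<^sub>Z) \<xi>"
      by (metis W\<^sub>Z_W\<^sub>Z rep_cov(1))
    moreover have "cnj d * d = 1"
      using d(1) complex_norm_square[of d] by (simp add: mult.commute)
    ultimately show ?thesis by (simp add: scaleC_scaleC scaleC_one)
  qed
  \<comment> \<open>A closed subspace invariant under \<open>\<pi>\<^sub>2\<close> is invariant
    under \<pi>: the images of \<open>A\<close> coincide and the unitaries differ by the scalar
    \<open>z\<close>.\<close>
  have "irreducible_representation B\<^sub>2 \<pi>\<^sub>2"
    unfolding irreducible_representation_def
  proof (intro conjI allI impI \<pi>\<^sub>2(1))
    fix M :: "'h set"
    assume M: "closed M \<and> subspace M \<and> (\<forall>c. \<forall>\<xi>\<in>M. c *\<^sub>C \<xi> \<in> M) \<and>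
      (\<forall>x\<in>carrier B\<^sub>2. \<forall>\<xi>\<in>M. \<pi>\<^sub>2 x \<xi> \<in> M)"
    have \<iota>_inv: "\<pi> (\<iota>\<^sub>Z a) \<xi> \<in> M" if "a \<in> carrier A" "\<xi> \<in> M" for a \<xi>
      using M that unital_star_homD(1)[OF \<iota>\<^sub>2] by (simp flip: \<pi>\<^sub>2(2))
    have W_inv: "\<pi> W\<^sub>Z \<xi> \<in> M" if "\<xi> \<in> M" for \<xi>
      using M that W by (simp add: \<pi>_W\<^sub>Z)
    have "\<pi> x \<xi> \<in> M" if x: "x \<in> carrier B\<^sub>Z" and "\<xi> \<in> M" for x \<xi>
    proof (rule R.invariant_if_generators_invariant[OF genZ x])
      fix y \<eta> assume y: "y \<in> \<iota>\<^sub>Z ` carrier A \<union> {W\<^sub>Z}" and \<eta>: "\<eta> \<in> M"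
      show "\<pi> y \<eta> \<in> M"
        using y \<eta> \<iota>_inv W_inv by auto
      show "\<pi> (star B\<^sub>Z y) \<eta> \<in> M"
        using y \<eta> \<iota>_inv W_inv M by (auto simp: star_\<iota> star_W\<^sub>Z)
    qed (use M that in auto)
    then show "M = {0} \<or> M = UNIV"
      using irr M unfolding irreducible_representation_def by blast
  qed
  then show "\<exists>\<pi>\<^sub>2 z. irreducible_representation B\<^sub>2 \<pi>\<^sub>2 \<and> cmod z = 1 \<and>
      (\<forall>a\<in>carrier A. \<pi> (\<iota>\<^sub>Z a) = \<pi>\<^sub>2 (\<iota>\<^sub>2 a)) \<and> \<pi> W\<^sub>Z = (\<lambda>\<xi>. z *\<^sub>C \<pi>\<^sub>2 W \<xi>)"
    using z \<pi>\<^sub>2(2) \<pi>_W\<^sub>Z by (intro exI[of _ \<pi>\<^sub>2] exI[of _ z]) auto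
qed

end
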